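(* Let $\Bbbk$ be an algebraically closed field of characteristic $0$ and let $\mathcal{J}$ be the super Jordan plane over $\Bbbk$, with $s=xy+yx$ and localization $\mathcal{J}_s$ at the powers of $s$. Then: (1) The set of isomorphism classes of finite-dimensional simple $\mathcal{J}$-modules is $\{[S_\alpha]\mid\alpha\in\Bbbk\}$, where $S_\alpha:=\mathcal{J}/\langle s,x,y-\alpha\rangle$. In particular, every finite-dimensional simple $\mathcal{J}$-module is one-dimensional. (2) A simple $\mathcal{J}$-module $M$ is infinite-dimensional if and only if it is faithful, equivalently, if and only if the element $s$ acts bijectively on $M$. In this case, $M$ is naturally a simple $\mathcal{J}_s$-module.
   Context: The super Jordan plane $\mathcal{J}$ over a field $\Bbbk$ is the unital associative $\Bbbk$-algebra generated by $x,y$ with defining relations $x^2=0$ and $y^2x-xy^2-xyx=0$. Put $s:=xy+yx$. The element $s$ is normal ($s\mathcal{J}=\mathcal{J}s$; indeed $sx=xs$, $sy=(y-x)s$) and regular, so the localization $\mathcal{J}_s$ at the powers of $s$ exists and contains $\mathcal{J}$. All modules are left modules; dimension is over $\Bbbk$. $\langle\cdots\rangle$ denotes the two-sided ideal generated by the listed elements, and $[M]$ the isomorphism class of $M$. "Naturally a $\mathcal{J}_s$-module" means that the $\mathcal{J}$-action extends to $\mathcal{J}_s$ with $s^{-1}$ acting as the inverse of $s$. *)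

theory Defs
  imports
    "HOL-Algebra.Algebra"
    "HOL-Algebra.Algebraic_Closure_Type"
    "HOL-Library.Poly_Mapping"
    "HOL-Library.FuncSet"
begin

section \<open>Left modules over a (not necessarily commutative) ring\<close>

text \<open>
  The library's locale \<^locale>\<open>module\<close> requires a commutative ring of scalars. The following has
  the same axioms and uses the same record type, for an arbitrary ring.
\<close>

locale left_module = R?: ring R + M?: abelian_group M
  for R :: "('r, 'a) ring_scheme" (structure) and M :: "('r, 'm, 'z) module_scheme" (structure) +
  assumes smult_closed:
      "\<lbrakk>a \<in> carrier R; m \<in> carrier M\<rbrakk> \<Longrightarrow> a \<odot>\<^bsub>M\<^esub> m \<in> carrier M"
    and smult_l_distr:
      "\<lbrakk>a \<in> carrier R; b \<in> carrier R; m \<in> carrier M\<rbrakk> \<Longrightarrow>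
        (a \<oplus>\<^bsub>R\<^esub> b) \<odot>\<^bsub>M\<^esub> m = a \<odot>\<^bsub>M\<^esub> m \<oplus>\<^bsub>M\<^esub> b \<odot>\<^bsub>M\<^esub> m"
    and smult_r_distr:
      "\<lbrakk>a \<in> carrier R; m \<in> carrier M; m' \<in> carrier M\<rbrakk> \<Longrightarrow>
        a \<odot>\<^bsub>M\<^esub> (m \<oplus>\<^bsub>M\<^esub> m') = a \<odot>\<^bsub>M\<^esub> m \<oplus>\<^bsub>M\<^esub> a \<odot>\<^bsub>M\<^esub> m'"
    and smult_assoc1:
      "\<lbrakk>a \<in> carrier R; b \<in> carrier R; m \<in> carrier M\<rbrakk> \<Longrightarrow>
        (a \<otimes>\<^bsub>R\<^esub> b) \<odot>\<^bsub>M\<^esub> m = a \<odot>\<^bsub>M\<^esub> (b \<odot>\<^bsub>M\<^esub> m)"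
    and smult_one:
      "m \<in> carrier M \<Longrightarrow> \<one>\<^bsub>R\<^esub> \<odot>\<^bsub>M\<^esub> m = m"

definition simple_module ::
    "('r, 'a) ring_scheme \<Rightarrow> ('r, 'm, 'z) module_scheme \<Rightarrow> bool" where
  "simple_module R M \<longleftrightarrow>
     left_module R M \<and> carrier M \<noteq> {\<zero>\<^bsub>M\<^esub>} \<and>
     (\<forall>H. submodule H R M \<longrightarrow> H = {\<zero>\<^bsub>M\<^esub>} \<or> H = carrier M)"

definition faithful_module ::
    "('r, 'a) ring_scheme \<Rightarrow> ('r, 'm, 'z) module_scheme \<Rightarrow> bool" where
  "faithful_module R M \<longleftrightarrow>
     (\<forall>a\<in>carrier R. (\<forall>m\<in>carrier M. a \<odot>\<^bsub>M\<^esub> m = \<zero>\<^bsub>M\<^esub>) \<longrightarrow> a = \<zero>\<^bsub>R\<^esub>)"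

definition module_isomorphic ::
    "('r, 'a) ring_scheme \<Rightarrow> ('r, 'm, 'y) module_scheme \<Rightarrow> ('r, 'n, 'z) module_scheme \<Rightarrow> bool"
  where
  "module_isomorphic R M N \<longleftrightarrow>
     (\<exists>f. bij_betw f (carrier M) (carrier N) \<and>
          (\<forall>m\<in>carrier M. \<forall>m'\<in>carrier M. f (m \<oplus>\<^bsub>M\<^esub> m') = f m \<oplus>\<^bsub>N\<^esub> f m') \<and>
          (\<forall>a\<in>carrier R. \<forall>m\<in>carrier M. f (a \<odot>\<^bsub>M\<^esub> m) = a \<odot>\<^bsub>N\<^esub> f m))"

definition quotient_module :: "('r, 'a) ring_scheme \<Rightarrow> 'r set \<Rightarrow> ('r, 'r set) module" where
  "quotient_module R I =
     \<lparr>carrier = carrier (R Quot I), monoid.mult = monoid.mult (R Quot I),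
      monoid.one = monoid.one (R Quot I),
      ring.zero = ring.zero (R Quot I), ring.add = ring.add (R Quot I),
      module.smult = (\<lambda>a C. (I +>\<^bsub>R\<^esub> a) \<otimes>\<^bsub>R Quot I\<^esub> C)\<rparr>"


section \<open>Dimension\<close>

text \<open>The field of scalars is the whole type \<open>'k\<close>.\<close>

definition is_finite_basis :: "('k, 'm, 'z) module_scheme \<Rightarrow> 'm set \<Rightarrow> bool" where
  "is_finite_basis V B \<longleftrightarrow>
     finite B \<and> B \<subseteq> carrier V \<and>
     (\<forall>v\<in>carrier V. \<exists>!c. c \<in> B \<rightarrow>\<^sub>E UNIV \<and> v = (\<Oplus>\<^bsub>V\<^esub>b\<in>B. c b \<odot>\<^bsub>V\<^esub> b))"

definition has_dimension :: "('k, 'm, 'z) module_scheme \<Rightarrow> nat \<Rightarrow> bool" where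
  "has_dimension V n \<longleftrightarrow> (\<exists>B. is_finite_basis V B \<and> card B = n)"

definition finite_dimensional :: "('k, 'm, 'z) module_scheme \<Rightarrow> bool" where
  "finite_dimensional V \<longleftrightarrow> (\<exists>n. has_dimension V n)"


section \<open>Localization at the powers of a regular normal element\<close>

text \<open>
  Left fractions. The pair \<open>(n, a)\<close> stands for \<open>s^(-n) a\<close>. If \<open>s\<close> is regular, then
  \<open>s^(-n) a = s^(-m) b\<close> iff \<open>s^m a = s^n b\<close>. If \<open>s\<close> is also normal, there is a unique \<open>a'\<close>
  with \<open>s^m a = a' s^m\<close>, and then \<open>(s^(-n) a) (s^(-m) b) = s^(-(n + m)) a' b\<close>.
\<close>

definition frac_rel :: "('r, 'a) ring_scheme \<Rightarrow> 'r \<Rightarrow> ((nat \<times> 'r) \<times> (nat \<times> 'r)) set" where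
  "frac_rel R s =
     {((n, a), (m, b)) | n a m b. a \<in> carrier R \<and> b \<in> carrier R \<and>
        s [^]\<^bsub>R\<^esub> m \<otimes>\<^bsub>R\<^esub> a = s [^]\<^bsub>R\<^esub> n \<otimes>\<^bsub>R\<^esub> b}"

definition fraction :: "('r, 'a) ring_scheme \<Rightarrow> 'r \<Rightarrow> nat \<Rightarrow> 'r \<Rightarrow> (nat \<times> 'r) set" where
  "fraction R s n a = frac_rel R s `` {(n, a)}"

definition localization :: "('r, 'a) ring_scheme \<Rightarrow> 'r \<Rightarrow> (nat \<times> 'r) set ring" where
  "localization R s =
     \<lparr>carrier = {fraction R s n a | n a. a \<in> carrier R},
      monoid.mult = (\<lambda>P Q. \<Union>(n, a)\<in>P. \<Union>(m, b)\<in>Q.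
        \<Union>a'\<in>{a' \<in> carrier R. s [^]\<^bsub>R\<^esub> m \<otimes>\<^bsub>R\<^esub> a = a' \<otimes>\<^bsub>R\<^esub> s [^]\<^bsub>R\<^esub> m}.
          fraction R s (n + m) (a' \<otimes>\<^bsub>R\<^esub> b)),
      monoid.one = fraction R s 0 \<one>\<^bsub>R\<^esub>,
      ring.zero = fraction R s 0 \<zero>\<^bsub>R\<^esub>,
      ring.add = (\<lambda>P Q. \<Union>(n, a)\<in>P. \<Union>(m, b)\<in>Q.
        fraction R s (n + m) (s [^]\<^bsub>R\<^esub> m \<otimes>\<^bsub>R\<^esub> a \<oplus>\<^bsub>R\<^esub> s [^]\<^bsub>R\<^esub> n \<otimes>\<^bsub>R\<^esub> b))\<rparr>"

abbreviation localization_map :: "('r, 'a) ring_scheme \<Rightarrow> 'r \<Rightarrow> 'r \<Rightarrow> (nat \<times> 'r) set" where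
  "localization_map R s a \<equiv> fraction R s 0 a"

text \<open>
  \<open>N\<close> is the \<open>R\<close>-module \<open>M\<close>, with its action extended to the localization so that the inverse of
  \<open>s\<close> acts as the inverse of the action of \<open>s\<close>.
\<close>

definition extends_to_localization ::
    "('r, 'a) ring_scheme \<Rightarrow> 'r \<Rightarrow> ('r, 'm, 'y) module_scheme \<Rightarrow>
     ((nat \<times> 'r) set, 'm, 'z) module_scheme \<Rightarrow> bool" where
  "extends_to_localization R s M N \<longleftrightarrow>
     left_module (localization R s) N \<and>
     carrier N = carrier M \<and> ring.add N = ring.add M \<and> ring.zero N = ring.zero M \<and>
     (\<forall>a\<in>carrier R. \<forall>m\<in>carrier M. localization_map R s a \<odot>\<^bsub>N\<^esub> m = a \<odot>\<^bsub>M\<^esub> m) \<and>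
     (\<forall>m\<in>carrier M. inv\<^bsub>localization R s\<^esub> (localization_map R s s) \<odot>\<^bsub>N\<^esub> m =
        inv_into (carrier M) (\<lambda>m. s \<odot>\<^bsub>M\<^esub> m) m)"


section \<open>The super Jordan plane\<close>

datatype gen = Gen_x | Gen_y

text \<open>
  The free monoid on the two generators, written additively so that the library's multiplication
  of finitely supported functions (convolution) is that of the free algebra.
\<close>

datatype word = Word "gen list"

instantiation word :: monoid_add
begin

definition zero_word :: word where
  "0 = Word []"

fun plus_word :: "word \<Rightarrow> word \<Rightarrow> word" where
  "Word u + Word v = Word (u @ v)"

instance
proof
  fix a b c :: word
  show "a + b + c = a + (b + c)" by (cases a; cases b; cases c) simp
  show "0 + a = a" by (cases a) (simp add: zero_word_def)
  show "a + 0 = a" by (cases a) (simp add: zero_word_def)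
qed

end

type_synonym 'k free_alg = "word \<Rightarrow>\<^sub>0 'k"

definition free_x :: "'k::field free_alg" where
  "free_x = Poly_Mapping.single (Word [Gen_x]) 1"

definition free_y :: "'k::field free_alg" where
  "free_y = Poly_Mapping.single (Word [Gen_y]) 1"

definition free_scalar :: "'k::field \<Rightarrow> 'k free_alg" where
  "free_scalar c = Poly_Mapping.single 0 c"

abbreviation free_ring :: "'k::field free_alg ring" where
  "free_ring \<equiv> ring_of_type_algebra"

definition sjp_ideal :: "'k::field free_alg set" where
  "sjp_ideal = Idl\<^bsub>free_ring\<^esub>
     {free_x ^ 2, free_y ^ 2 * free_x - free_x * free_y ^ 2 - free_x * free_y * free_x}"

definition sjp :: "'k::field free_alg set ring" where
  "sjp = free_ring Quot sjp_ideal"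

definition sjp_x :: "'k::field free_alg set" where
  "sjp_x = sjp_ideal +>\<^bsub>free_ring\<^esub> free_x"

definition sjp_y :: "'k::field free_alg set" where
  "sjp_y = sjp_ideal +>\<^bsub>free_ring\<^esub> free_y"

definition sjp_scalar :: "'k::field \<Rightarrow> 'k free_alg set" where
  "sjp_scalar c = sjp_ideal +>\<^bsub>free_ring\<^esub> free_scalar c"

definition sjp_s :: "'k::field free_alg set" where
  "sjp_s = sjp_x \<otimes>\<^bsub>sjp\<^esub> sjp_y \<oplus>\<^bsub>sjp\<^esub> sjp_y \<otimes>\<^bsub>sjp\<^esub> sjp_x"

definition sjp_simple :: "'k::field \<Rightarrow> ('k free_alg set, 'k free_alg set set) module" where
  "sjp_simple \<alpha> = quotient_module sjp (Idl\<^bsub>sjp\<^esub> {sjp_s, sjp_x, sjp_y \<ominus>\<^bsub>sjp\<^esub> sjp_scalar \<alpha>})"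

definition underlying_space ::
    "('k::field free_alg set, 'm, 'z) module_scheme \<Rightarrow> ('k, 'm) module" where
  "underlying_space M =
     \<lparr>carrier = carrier M, monoid.mult = monoid.mult M, monoid.one = monoid.one M,
      ring.zero = ring.zero M, ring.add = ring.add M,
      module.smult = (\<lambda>c m. sjp_scalar c \<odot>\<^bsub>M\<^esub> m)\<rparr>"

end

(*
Put z = y^2; then zs - sz = s^2, zx = x(z + s), and J = W + xW + yW + xyW, where W is spanned by
the monomials s^i z^j. On a simple module M the kernel and the image of s are submodules, so s acts
as 0 or bijectively.

If s acts as 0, so does x, because its kernel is then a nonzero submodule. Hence M is a simple
module over k[y], thus a line on which y acts by a scalar alpha, and y - alpha is a nonzero element
killing M.

If s acts bijectively, the relation above makes its inverse t satisfy tz - zt = 1, which is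
impossible in finite dimension and characteristic 0 by taking traces. The annihilator I of M is an
ideal from which s can be cancelled on either side. Commutators with z and s differentiate the
elements of W with respect to s and z, so W and I meet in 0; multiplying an element of I by x on
either side isolates its components in W + xW + yW + xyW, whence I = 0.
*)
theory Submission
  imports Defs
begin


section \<open>The super Jordan plane as a type\<close>

text \<open>The relation tz - zt = 1 is that of the first Weyl algebra, and the treatment of the
  annihilator I follows the classical proof that this algebra is simple in characteristic 0:
  commutators lower the degree of a polynomial until a nonzero constant is reached. Since the
  inverse t of s does not lie in J, the commutators are formed with s and z themselves; each then
  carries extra factors s, which is why I must allow cancellation of s on both sides. The case where
  s acts as 0 has its own obstacle. The module is only known to be simple, so no polynomial relation
  for y is available at the start. Simplicity supplies one: for a nonzero v, the polynomials in y
  applied to yv form a submodule, and if it is not zero it contains v itself, which gives a nonzero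
  polynomial in y killing v. Both cases are proved for an arbitrary simple module. Dimension,
  faithfulness and bijectivity of s are thereby settled together in each case, and the equivalences
  follow by comparing the two.\<close>

lemma ring_of_type_algebra_simps [simp]:
  "carrier (ring_of_type_algebra :: 'a::ring_1 ring) = UNIV"
  "monoid.mult (ring_of_type_algebra :: 'a ring) = (*)" "monoid.one (ring_of_type_algebra :: 'a ring) = 1"
  "ring.zero (ring_of_type_algebra :: 'a ring) = 0" "ring.add (ring_of_type_algebra :: 'a ring) = (+)"
  by (auto simp: ring_of_type_algebra_def fun_eq_iff)

lemma ring_of_type_algebra: "ring (ring_of_type_algebra :: 'a::ring_1 ring)"
proof -
  have "\<exists>y. x + y = 0" for x :: 'a using add.right_inverse by blast
  then show ?thesis
    unfolding ring_of_type_algebra_def using add.right_inverse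
    by unfold_locales (auto simp: algebra_simps Units_def)
qed

interpretation free: ring "free_ring :: 'k::field free_alg ring"
  by (rule ring_of_type_algebra)

lemma free_minus [simp]: "a \<ominus>\<^bsub>free_ring\<^esub> b = a - (b :: 'k::field free_alg)"
  using free.minus_equality[of "-b" b] by (simp add: a_minus_def)

lemma ideal_sjp_ideal: "ideal (sjp_ideal :: 'k::field free_alg set) free_ring"
  unfolding sjp_ideal_def by (rule free.genideal_ideal) simp

interpretation sjp: ring "sjp :: 'k::field free_alg set ring"
  unfolding sjp_def by (rule ideal.quotient_is_ring[OF ideal_sjp_ideal])

lemma sjp_coset_hom: "(+>\<^bsub>free_ring\<^esub>) sjp_ideal \<in> ring_hom free_ring (sjp :: 'k::field free_alg set ring)"
  unfolding sjp_def by (rule ideal.rcos_ring_hom[OF ideal_sjp_ideal])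

lemmas sjp_coset_zero = ring_hom_zero[OF sjp_coset_hom ring_of_type_algebra sjp.ring_axioms]
  and sjp_coset_one = ring_hom_one[OF sjp_coset_hom]

lemma carrier_sjp: "carrier sjp = range ((+>\<^bsub>free_ring\<^esub>) (sjp_ideal :: 'k::field free_alg set))"
  by (auto simp: sjp_def FactRing_def A_RCOSETS_def' )

lemma coset_eq_iff:
  "sjp_ideal +>\<^bsub>free_ring\<^esub> a = sjp_ideal +>\<^bsub>free_ring\<^esub> b \<longleftrightarrow> a - b \<in> (sjp_ideal :: 'k::field free_alg set)"
  using free.quotient_eq_iff_same_a_r_cos[OF ideal_sjp_ideal, of a b] by simp

section \<open>Characters of the free algebra and of its quotient\<close>

definition word_value :: "'k::field \<Rightarrow> word \<Rightarrow> 'k" where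
  "word_value \<alpha> w = (case w of Word gs \<Rightarrow> prod_list (map (\<lambda>g. if g = Gen_x then 0 else \<alpha>) gs))"

lemma word_value_simps [simp]:
  "word_value \<alpha> 0 = 1" "word_value \<alpha> (u + v) = word_value \<alpha> u * word_value \<alpha> v"
  "word_value \<alpha> (Word [Gen_x]) = 0" "word_value \<alpha> (Word [Gen_y]) = \<alpha>"
  by (auto simp: word_value_def zero_word_def, cases u, cases v, auto)

definition free_char :: "'k::field \<Rightarrow> 'k free_alg \<Rightarrow> 'k" where
  "free_char \<alpha> f = (\<Sum>w\<in>Poly_Mapping.keys f. Poly_Mapping.lookup f w * word_value \<alpha> w)"

lemma free_char_single [simp]: "free_char \<alpha> (Poly_Mapping.single w c) = c * word_value \<alpha> w"
  by (simp add: free_char_def)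

lemma free_char_add [simp]: "free_char \<alpha> (f + g) = free_char \<alpha> f + free_char \<alpha> g"
  unfolding free_char_def
  by (rule setsum_keys_plus_distrib) (auto simp: algebra_simps)

lemma free_char_zero [simp]: "free_char \<alpha> 0 = 0"
  by (simp add: free_char_def)

lemma free_char_one [simp]: "free_char \<alpha> 1 = 1"
  by (simp flip: single_one)

lemma free_char_diff [simp]: "free_char \<alpha> (f - g) = free_char \<alpha> f - free_char \<alpha> g"
  using free_char_add[of \<alpha> "f - g" g] by simp

lemma update_eq_single_add:
  fixes f :: "'a \<Rightarrow>\<^sub>0 'b::comm_monoid_add"
  assumes "a \<notin> Poly_Mapping.keys f"
  shows "Poly_Mapping.update a b f = Poly_Mapping.single a b + f"
  using assms
  by (intro poly_mapping_eqI) (auto simp: lookup_add lookup_update lookup_single in_keys_iff)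

text \<open>A finitely supported function is a sum of monomials, so an additive statement only has
  to be checked on single monomials; coefficient sums over supports are thereby avoided.\<close>

lemma free_alg_single_induct [case_names zero add]:
  fixes f :: "'k::field free_alg"
  assumes "P 0" "\<And>w c g. P g \<Longrightarrow> P (Poly_Mapping.single w c + g)"
  shows "P f"
  by (induction f rule: update_induct) (auto simp: assms update_eq_single_add)

lemma free_char_mult [simp]: "free_char \<alpha> (f * g) = free_char \<alpha> f * free_char \<alpha> g"
proof (induction f rule: free_alg_single_induct)
  case (add w c f)
  have "free_char \<alpha> (Poly_Mapping.single w c * g)
      = free_char \<alpha> (Poly_Mapping.single w c) * free_char \<alpha> g"
    by (induction g rule: free_alg_single_induct) (auto simp: algebra_simps mult_single)
  with add show ?case by (simp add: algebra_simps)
qed simp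

text \<open>The character x -> 0, y -> \<alpha> has an ideal as its kernel, and every term of both
  defining relations contains x. These characters are what separates elements of J: they show that 1
  is nonzero, that the ideals defining the modules \<open>sjp_simple\<close> are proper, and that y
  - \<alpha> is nonzero.\<close>

lemma sjp_ideal_free_char:
  assumes "f \<in> sjp_ideal" shows "free_char \<alpha> f = 0"
proof -
  have "ideal {f. free_char \<alpha> f = 0} free_ring"
  proof (rule idealI[OF ring_of_type_algebra])
    show "subgroup {f. free_char \<alpha> f = 0} (add_monoid free_ring)"
    proof (rule subgroup.intro)
      fix f assume "f \<in> {f. free_char \<alpha> f = 0}"
      moreover have "inv\<^bsub>add_monoid free_ring\<^esub> f = 0 - f"
        using free_minus[of 0 f] unfolding a_minus_def a_inv_def by simp
      ultimately show "inv\<^bsub>add_monoid free_ring\<^esub> f \<in> {f. free_char \<alpha> f = 0}"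
        using free_char_diff[of \<alpha> 0 f] by simp
    qed auto
  qed auto
  then have "sjp_ideal \<subseteq> {f. free_char \<alpha> f = 0}"
    unfolding sjp_ideal_def
    by (rule free.genideal_minimal)
      (auto simp: free_x_def free_y_def power2_eq_square mult_single word_value_def)
  with assms show ?thesis by auto
qed

text \<open>A type copy of the carrier makes J an instance of \<open>ring_1\<close>, so that
  computations inside J are free of membership conditions; \<open>Rep_super_jordan\<close> leads
  back to the quotient ring.\<close>

typedef (overloaded) 'k super_jordan = "carrier (sjp :: 'k::field free_alg set ring)"
  by (rule exI[of _ "\<zero>\<^bsub>sjp\<^esub>"]) simp

lemmas Rep_carrier [simp] = Rep_super_jordan

definition proj :: "'k::field free_alg \<Rightarrow> 'k super_jordan" where
  "proj f = Abs_super_jordan (sjp_ideal +>\<^bsub>free_ring\<^esub> f)"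

lemma Rep_proj: "Rep_super_jordan (proj f) = sjp_ideal +>\<^bsub>free_ring\<^esub> f"
  by (simp add: proj_def Abs_super_jordan_inverse carrier_sjp)

lemma proj_surj: obtains f where "a = proj f"
  using Rep_super_jordan[of a] unfolding carrier_sjp
  by (metis Rep_super_jordan_inverse imageE proj_def)

lemma proj_eq_iff: "proj f = proj g \<longleftrightarrow> f - g \<in> sjp_ideal"
  by (simp add: Rep_super_jordan_inject[symmetric] Rep_proj coset_eq_iff)

instantiation super_jordan :: (field) ring_1
begin

definition "0 = Abs_super_jordan \<zero>\<^bsub>sjp\<^esub>"
definition "1 = Abs_super_jordan \<one>\<^bsub>sjp\<^esub>"
definition "a + b = Abs_super_jordan (Rep_super_jordan a \<oplus>\<^bsub>sjp\<^esub> Rep_super_jordan b)"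
definition "a * b = Abs_super_jordan (Rep_super_jordan a \<otimes>\<^bsub>sjp\<^esub> Rep_super_jordan b)"
definition "- a = Abs_super_jordan (\<ominus>\<^bsub>sjp\<^esub> Rep_super_jordan a)"
definition "a - b = Abs_super_jordan (Rep_super_jordan a \<ominus>\<^bsub>sjp\<^esub> Rep_super_jordan b)"

lemma Rep_super_jordan_simps [simp]:
  "Rep_super_jordan 0 = \<zero>\<^bsub>sjp\<^esub>" "Rep_super_jordan 1 = \<one>\<^bsub>sjp\<^esub>"
  "Rep_super_jordan (a + b) = Rep_super_jordan a \<oplus>\<^bsub>sjp\<^esub> Rep_super_jordan b"
  "Rep_super_jordan (a * b) = Rep_super_jordan a \<otimes>\<^bsub>sjp\<^esub> Rep_super_jordan b"
  "Rep_super_jordan (- a) = \<ominus>\<^bsub>sjp\<^esub> Rep_super_jordan a"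
  "Rep_super_jordan (a - b) = Rep_super_jordan a \<ominus>\<^bsub>sjp\<^esub> Rep_super_jordan b"
  by (simp_all add: zero_super_jordan_def one_super_jordan_def plus_super_jordan_def
      times_super_jordan_def uminus_super_jordan_def minus_super_jordan_def
      Abs_super_jordan_inverse)

instance
proof
  fix a b c :: "'a super_jordan"
  note [simp] = Rep_super_jordan_inject[symmetric]
  show "a + b + c = a + (b + c)" by (simp add: sjp.a_assoc)
  show "a + b = b + a" by (simp add: sjp.a_comm)
  show "0 + a = a" by simp
  show "- a + a = 0" by (simp add: sjp.l_neg)
  show "a - b = a + - b" by (simp add: a_minus_def)
  show "a * b * c = a * (b * c)" by (simp add: sjp.m_assoc)
  show "1 * a = a" by simp
  show "a * 1 = a" by simp
  show "(a + b) * c = a * c + b * c" by (simp add: sjp.l_distr)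
  show "a * (b + c) = a * b + a * c" by (simp add: sjp.r_distr)
  \<comment> \<open>The character at \<alpha> = 0 takes the value -1 on this element but vanishes on
    the ideal.\<close>
  have "(0 :: 'a free_alg) - 1 \<notin> sjp_ideal"
    using sjp_ideal_free_char[of "0 - 1 :: 'a free_alg" 0] free_char_diff[of 0 0 "1 :: 'a free_alg"]
    by auto
  then have "sjp_ideal +>\<^bsub>free_ring\<^esub> 0 \<noteq> sjp_ideal +>\<^bsub>free_ring\<^esub> (1 :: 'a free_alg)"
    by (simp add: coset_eq_iff)
  moreover have "sjp_ideal +>\<^bsub>free_ring\<^esub> 0 = \<zero>\<^bsub>sjp :: 'a free_alg set ring\<^esub>"
    "sjp_ideal +>\<^bsub>free_ring\<^esub> 1 = \<one>\<^bsub>sjp :: 'a free_alg set ring\<^esub>"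
    using sjp_coset_zero sjp_coset_one by simp_all
  ultimately show "(0 :: 'a super_jordan) \<noteq> 1" by simp
qed

end

lemma proj_simps [simp]:
  "proj 0 = 0" "proj 1 = 1" "proj (f + g) = proj f + proj g" "proj (f * g) = proj f * proj g"
  "proj (f - g) = proj f - proj g"
proof -
  note [simp] = Rep_super_jordan_inject[symmetric] Rep_proj
  show 0: "proj 0 = 0" using sjp_coset_zero by simp
  show "proj 1 = 1" using sjp_coset_one by simp
  have add: "proj (f + g) = proj f + proj g" for f g using ring_hom_add[OF sjp_coset_hom, of f g] by simp
  then show "proj (f + g) = proj f + proj g" .
  show "proj (f * g) = proj f * proj g" using ring_hom_mult[OF sjp_coset_hom, of f g] by simp
  show "proj (f - g) = proj f - proj g" using add[of "f - g" g] by (simp del: Rep_super_jordan_inject[symmetric] add: eq_diff_eq)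
qed

definition J_x :: "'k::field super_jordan" where "J_x = proj free_x"
definition J_y :: "'k::field super_jordan" where "J_y = proj free_y"
definition J_scalar :: "'k::field \<Rightarrow> 'k super_jordan" where "J_scalar c = proj (free_scalar c)"
definition J_s :: "'k::field super_jordan" where "J_s = J_x * J_y + J_y * J_x"

lemma Rep_generators:
  "Rep_super_jordan J_x = sjp_x" "Rep_super_jordan J_y = sjp_y"
  "Rep_super_jordan (J_scalar c) = sjp_scalar c" "Rep_super_jordan J_s = sjp_s"
  by (simp_all add: J_x_def J_y_def J_scalar_def J_s_def sjp_s_def Rep_proj sjp_x_def sjp_y_def
      sjp_scalar_def)

lemma J_scalar_simps [simp]:
  fixes c d :: "'k::field"
  shows "J_scalar (0::'k) = 0" "J_scalar (1::'k) = 1" "J_scalar (c + d) = J_scalar c + J_scalar d"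
  "J_scalar (c * d) = J_scalar c * J_scalar d"
  "J_scalar (c - d) = J_scalar c - J_scalar d"
proof -
  show "J_scalar (0::'k) = 0" "J_scalar (1::'k) = 1"
    by (simp_all add: J_scalar_def free_scalar_def)
  have add: "J_scalar (c + d) = J_scalar c + J_scalar d" for c d :: 'k
    by (simp add: J_scalar_def free_scalar_def single_add)
  then show "J_scalar (c + d) = J_scalar c + J_scalar d" .
  show "J_scalar (c * d) = J_scalar c * J_scalar d"
    by (simp add: J_scalar_def free_scalar_def mult_single flip: proj_simps)
  show "J_scalar (c - d) = J_scalar c - J_scalar d"
    using add[of "c - d" d] by (simp add: eq_diff_eq)
qed

lemma super_jordan_relations:
  "J_x * J_x = (0 :: 'k::field super_jordan)"
  "J_y * J_y * J_x = J_x * J_y * J_y + J_x * J_y * (J_x :: 'k super_jordan)"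
proof -
  have gen: "f \<in> sjp_ideal"
    if "f \<in> {free_x ^ 2, free_y ^ 2 * free_x - free_x * free_y ^ 2 - free_x * free_y * free_x}"
    for f :: "'k free_alg"
    unfolding sjp_ideal_def using free.genideal_self[THEN subsetD, OF _ that] by simp
  have "proj (free_x ^ 2) = (proj 0 :: 'k super_jordan)"
    unfolding proj_eq_iff using gen by simp
  then show "J_x * J_x = (0 :: 'k super_jordan)" by (simp add: J_x_def power2_eq_square)
  have "proj (free_y ^ 2 * free_x - free_x * free_y ^ 2 - free_x * free_y * free_x)
      = (proj 0 :: 'k super_jordan)"
    unfolding proj_eq_iff using gen by simp
  then show "J_y * J_y * J_x = J_x * J_y * J_y + J_x * J_y * (J_x :: 'k super_jordan)"
    by (simp add: J_x_def J_y_def power2_eq_square algebra_simps)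
qed

text \<open>J is generated by the scalars, x and y: a representative is a sum of scalar multiples of
  words, and a word is a product of letters. Most later facts about arbitrary elements are checked
  on generators through this rule.\<close>

lemma super_jordan_induct [case_names scalar x y add mult]:
  fixes a :: "'k::field super_jordan"
  assumes scalar: "\<And>c. P (J_scalar c)" and x: "P J_x" and y: "P J_y"
    and add: "\<And>a b. P a \<Longrightarrow> P b \<Longrightarrow> P (a + b)"
    and mult: "\<And>a b. P a \<Longrightarrow> P b \<Longrightarrow> P (a * b)"
  shows "P a"
proof -
  obtain f where f: "a = proj f" by (rule proj_surj)
  have word: "P (proj (Poly_Mapping.single (Word gs) 1))" for gs
  proof (induction gs)
    case Nil
    then show ?case using scalar[of 1] by (simp flip: zero_word_def)
  next
    case (Cons g gs)
    have "P (proj (Poly_Mapping.single (Word [g]) 1))"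
      using x y by (cases g) (simp_all add: J_x_def J_y_def free_x_def free_y_def)
    from mult[OF this Cons] show ?case
      by (simp add: mult_single flip: proj_simps)
  qed
  have "P (proj f)"
  proof (induction f rule: free_alg_single_induct)
    case zero
    then show ?case using scalar[of 0] by simp
  next
    case (add w c f)
    obtain gs where w: "w = Word gs" by (cases w)
    have "proj (Poly_Mapping.single w c) = J_scalar c * proj (Poly_Mapping.single w 1)"
      by (simp add: J_scalar_def free_scalar_def mult_single flip: proj_simps)
    then show ?case using add word[of gs] scalar[of c] by (simp add: w assms(4) mult)
  qed
  with f show ?thesis by simp
qed

lemma J_scalar_central: "J_scalar c * a = a * J_scalar c"
proof (induction a rule: super_jordan_induct)
  case (scalar d)
  show ?case by (simp add: mult.commute flip: J_scalar_simps)
next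
  case x
  show ?case by (simp add: J_scalar_def J_x_def free_x_def free_scalar_def mult_single flip: proj_simps)
next
  case y
  show ?case by (simp add: J_scalar_def J_y_def free_y_def free_scalar_def mult_single flip: proj_simps)
next
  case (add a b)
  then show ?case by (simp add: algebra_simps)
next
  case (mult a b)
  then show ?case by (metis mult.assoc)
qed

text \<open>The chosen representative is irrelevant because \<open>free_char\<close> vanishes on
  \<open>sjp_ideal\<close>; see \<open>J_char_proj\<close>.\<close>

definition J_char :: "'k::field \<Rightarrow> 'k super_jordan \<Rightarrow> 'k" where
  "J_char \<alpha> a = free_char \<alpha> (SOME f. a = proj f)"

lemma J_char_proj [simp]: "J_char \<alpha> (proj f) = free_char \<alpha> f"
proof -
  have "proj f = proj (SOME g. proj f = proj g)" by (rule someI) simp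
  then have "f - (SOME g. proj f = proj g) \<in> sjp_ideal" unfolding proj_eq_iff .
  from sjp_ideal_free_char[OF this, of \<alpha>] show ?thesis by (simp add: J_char_def)
qed

lemma J_char_simps [simp]:
  "J_char \<alpha> (a + b) = J_char \<alpha> a + J_char \<alpha> b" "J_char \<alpha> (a * b) = J_char \<alpha> a * J_char \<alpha> b"
  "J_char \<alpha> (a - b) = J_char \<alpha> a - J_char \<alpha> b"
  "J_char \<alpha> 0 = 0" "J_char \<alpha> 1 = 1"
  "J_char \<alpha> (J_scalar c) = c" "J_char \<alpha> J_x = 0" "J_char \<alpha> J_y = \<alpha>" "J_char \<alpha> J_s = 0"
proof -
  obtain f where f: "a = proj f" by (rule proj_surj)
  obtain g where g: "b = proj g" by (rule proj_surj)
  note [simp del] = proj_simps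
  show "J_char \<alpha> (a + b) = J_char \<alpha> a + J_char \<alpha> b" "J_char \<alpha> (a * b) = J_char \<alpha> a * J_char \<alpha> b"
     "J_char \<alpha> (a - b) = J_char \<alpha> a - J_char \<alpha> b"
    by (simp_all add: f g flip: proj_simps)
  show "J_char \<alpha> 0 = 0" "J_char \<alpha> 1 = 1"
    by (simp_all flip: proj_simps)
  show "J_char \<alpha> (J_scalar c) = c" "J_char \<alpha> J_x = 0" "J_char \<alpha> J_y = \<alpha>" "J_char \<alpha> J_s = 0"
    by (simp_all add: J_scalar_def J_s_def J_x_def J_y_def free_scalar_def free_x_def free_y_def
        flip: proj_simps)
qed


section \<open>Ideals from which the normal element can be cancelled\<close>

definition J_z :: "'k::field super_jordan" where "J_z = J_y * J_y"

text \<open>Oriented from left to right, the rules sort products into the order s, x, z, y with at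
  most one x and one y. The second half repeats the first with a factor \<open>w\<close> behind, so
  that the rules also apply inside right-nested products.\<close>

lemma super_jordan_rewrite:
  fixes w :: "'k::field super_jordan"
  shows
    "J_x * J_x = (0 :: 'k super_jordan)" "J_y * J_y = (J_z :: 'k super_jordan)"
    "J_x * J_s = J_s * (J_x :: 'k super_jordan)"
    "J_y * J_s = J_s * J_y + J_s * (J_x :: 'k super_jordan)"
    "J_y * J_x = J_s - J_x * (J_y :: 'k super_jordan)"
    "J_y * J_z = J_z * (J_y :: 'k super_jordan)"
    "J_z * J_s = J_s * J_z + J_s * (J_s :: 'k super_jordan)"
    "J_z * J_x = J_x * J_z + J_s * (J_x :: 'k super_jordan)"
    "J_x * (J_x * w) = 0" "J_y * (J_y * w) = J_z * w"
    "J_x * (J_s * w) = J_s * (J_x * w)"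
    "J_y * (J_s * w) = J_s * (J_y * w) + J_s * (J_x * w)"
    "J_y * (J_x * w) = J_s * w - J_x * (J_y * w)"
    "J_y * (J_z * w) = J_z * (J_y * w)"
    "J_z * (J_s * w) = J_s * (J_z * w) + J_s * (J_s * w)"
    "J_z * (J_x * w) = J_x * (J_z * w) + J_s * (J_x * w)"
proof -
  note s_def = J_s_def[where 'k = 'k]
  show xx: "J_x * J_x = (0 :: 'k super_jordan)" by (rule super_jordan_relations)
  show yy: "J_y * J_y = (J_z :: 'k super_jordan)" by (simp add: J_z_def)
  have xxw: "J_x * (J_x * w) = 0" for w :: "'k super_jordan" by (simp add: xx flip: mult.assoc)
  show xs: "J_x * J_s = J_s * (J_x :: 'k super_jordan)"
    by (simp add: s_def algebra_simps xx xxw)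
  have rel: "J_y * (J_y * J_x) = J_x * (J_y * J_y) + J_x * (J_y * (J_x :: 'k super_jordan))"
    using super_jordan_relations(2)[where 'k = 'k] by (simp add: mult.assoc)
  \<comment> \<open>The cubic defining relation enters here, through \<open>rel\<close>. The rules
    for z then follow by moving the two factors y of z past s or x one after the other.\<close>
  show ys: "J_y * J_s = J_s * J_y + J_s * (J_x :: 'k super_jordan)"
    by (simp add: s_def algebra_simps xx xxw rel)
  show yx: "J_y * J_x = J_s - J_x * (J_y :: 'k super_jordan)"
    by (simp add: s_def)
  show yz: "J_y * J_z = J_z * (J_y :: 'k super_jordan)" by (simp add: J_z_def mult.assoc)
  have ysw: "J_y * (J_s * w) = J_s * (J_y * w) + J_s * (J_x * w)" for w :: "'k super_jordan"
    by (metis ys mult.assoc distrib_right)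
  have yxw: "J_y * (J_x * w) = J_s * w - J_x * (J_y * w)" for w :: "'k super_jordan"
    by (metis yx mult.assoc left_diff_distrib)
  show zs: "J_z * J_s = J_s * J_z + J_s * (J_s :: 'k super_jordan)"
    unfolding J_z_def by (simp add: mult.assoc ys ysw algebra_simps yx xx)
  show zx: "J_z * J_x = J_x * J_z + J_s * (J_x :: 'k super_jordan)"
    unfolding J_z_def by (simp add: mult.assoc ys ysw algebra_simps yx yxw)
  show "J_x * (J_x * w) = 0" "J_y * (J_y * w) = J_z * w"
    "J_x * (J_s * w) = J_s * (J_x * w)" "J_y * (J_z * w) = J_z * (J_y * w)"
    "J_y * (J_s * w) = J_s * (J_y * w) + J_s * (J_x * w)"
    "J_y * (J_x * w) = J_s * w - J_x * (J_y * w)"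
    using xxw ysw yxw yy xs yz by (metis mult.assoc)+
  show "J_z * (J_s * w) = J_s * (J_z * w) + J_s * (J_s * w)"
    by (metis zs mult.assoc distrib_right)
  show "J_z * (J_x * w) = J_x * (J_z * w) + J_s * (J_x * w)"
    by (metis zx mult.assoc distrib_right)
qed

section \<open>Polynomials in s and z, differentiated by commutators\<close>

definition horner :: "('c::zero \<Rightarrow> 'a::ring_1) \<Rightarrow> 'a \<Rightarrow> 'c poly \<Rightarrow> 'a" where
  "horner h a p = fold_coeffs (\<lambda>c b. h c + a * b) p 0"

lemma horner_0 [simp]: "horner h a 0 = 0"
  by (simp add: horner_def)

lemma horner_pCons [simp]: "h 0 = 0 \<Longrightarrow> horner h a (pCons c p) = h c + a * horner h a p"
  by (cases "c = 0 \<and> p = 0") (auto simp: horner_def)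

lemma horner_add:
  assumes "h 0 = 0" "\<And>c d. h (c + d) = h c + h d"
  shows "horner h a (p + q) = horner h a p + horner h a q"
  by (induction p q rule: poly_induct2) (simp_all add: assms algebra_simps)

text \<open>In characteristic 0 a nonconstant polynomial has a nonzero derivative of smaller degree,
  so a polynomial whose value lies in \<open>I\<close> can be differentiated down to a constant. The
  coefficient type is left general because the rule serves twice: for polynomials in z over the
  field, and for polynomials in s over polynomials in z.\<close>

lemma horner_eq_0_of_pderiv:
  fixes p :: "'c::{comm_semiring_1,semiring_no_zero_divisors,semiring_char_0} poly"
  assumes h: "h 0 = 0"
    and pderiv: "\<And>p. horner h a p \<in> I \<Longrightarrow> horner h a (pderiv p) \<in> I"
    and const: "\<And>c. h c \<in> I \<Longrightarrow> c = 0"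
    and "horner h a p \<in> I"
  shows "p = 0"
  using assms(4)
proof (induction "degree p" arbitrary: p rule: less_induct)
  case less
  show ?case
  proof (cases "degree p = 0")
    case True
    then obtain c where "p = [:c:]" by (rule degree_eq_zeroE)
    with less.prems const[of c] show ?thesis by (simp add: h)
  next
    case False
    then have "degree (pderiv p) < degree p" by (simp add: degree_pderiv)
    from less.hyps[OF this pderiv[OF less.prems]] have "pderiv p = 0" .
    with False show ?thesis by (simp add: pderiv_eq_0_iff)
  qed
qed

definition eval_z :: "'k::field poly \<Rightarrow> 'k super_jordan" where
  "eval_z = horner J_scalar J_z"

text \<open>Powers of s stand to the left of their coefficients, which are polynomials in z. Hence
  \<open>pderiv\<close> on the outer level differentiates with respect to s.\<close>

definition eval_sz :: "'k::field poly poly \<Rightarrow> 'k super_jordan" where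
  "eval_sz = horner eval_z J_s"

lemma eval_z_simps [simp]:
  fixes p q :: "'k::field poly"
  shows "eval_z (0 :: 'k poly) = 0" "eval_z (pCons c p) = J_scalar c + J_z * eval_z p"
    "eval_z (p + q) = eval_z p + eval_z q"
  by (simp_all add: eval_z_def horner_add)

lemma eval_sz_simps [simp]:
  fixes P Q :: "'k::field poly poly"
  shows "eval_sz (0 :: 'k poly poly) = 0" "eval_sz (pCons p P) = eval_z p + J_s * eval_sz P"
    "eval_sz (P + Q) = eval_sz P + eval_sz Q"
  by (simp_all add: eval_sz_def horner_add)

lemma J_scalar_minus: "J_scalar (- c) = - J_scalar c"
  using J_scalar_simps(5)[of 0 c] by (simp del: J_scalar_simps(5))

lemma J_scalar_left_commute: "a * (J_scalar c * b) = J_scalar c * (a * b)"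
  by (metis J_scalar_central mult.assoc)

lemma eval_z_commutes: "J_z * eval_z p = eval_z p * J_z"
proof (induction p)
  case (pCons c p)
  then show ?case
    by (simp add: distrib_left distrib_right J_scalar_central mult.assoc flip: pCons.IH)
qed simp

text \<open>With t inverse to s, tz - zt = 1 would give t p(z) - p(z) t = p'(z). Multiplication by s
  on both sides turns this into an identity without inverses, valid in J.\<close>

lemma eval_z_commutator:
  "eval_z p * J_s = J_s * eval_z p + J_s * (eval_z (pderiv p) * J_s)"
proof (induction p)
  case (pCons c p)
  have "eval_z (pCons c p) * J_s = J_s * J_scalar c + J_z * (eval_z p * J_s)"
    by (simp add: algebra_simps J_scalar_central)
  also have "J_z * (eval_z p * J_s)
      = J_s * (J_z * eval_z p) + J_s * (J_s * eval_z p)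
        + (J_s * (J_z * (eval_z (pderiv p) * J_s)) + J_s * (J_s * (eval_z (pderiv p) * J_s)))"
    unfolding pCons.IH by (simp add: distrib_left super_jordan_rewrite)
  \<comment> \<open>A second use of the induction hypothesis, read backwards: it produces the
    product rule term s p(z) s and cancels the surplus s s p'(z) s.\<close>
  also have "J_s * (J_s * eval_z p) = J_s * (eval_z p * J_s) - J_s * (J_s * (eval_z (pderiv p) * J_s))"
    unfolding pCons.IH by (simp add: distrib_left)
  finally show ?case by (simp add: pderiv_pCons algebra_simps)
qed simp

text \<open>Because zs - sz = s^2 and z commutes with the coefficients, the commutator with z is the
  derivation s^2 d/ds.\<close>

lemma eval_sz_commutator:
  "J_z * eval_sz P = eval_sz P * J_z + J_s * (J_s * eval_sz (pderiv P))"
  by (induction P)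
    (simp_all add: pderiv_pCons algebra_simps super_jordan_rewrite eval_z_commutes)

text \<open>The span of the monomials \<open>s^i z^j\<close>.\<close>

inductive_set J_even :: "'k::field super_jordan set" where
  scalar: "J_scalar c \<in> J_even"
| add: "v \<in> J_even \<Longrightarrow> w \<in> J_even \<Longrightarrow> v + w \<in> J_even"
| s: "w \<in> J_even \<Longrightarrow> J_s * w \<in> J_even"
| z: "w \<in> J_even \<Longrightarrow> J_z * w \<in> J_even"

lemma J_even_0 [simp]: "0 \<in> J_even"
  using J_even.scalar[of 0] by simp

lemma J_even_scalar_mult: "w \<in> J_even \<Longrightarrow> J_scalar c * w \<in> J_even"
proof (induction rule: J_even.induct)
  case (scalar d)
  then show ?case using J_even.scalar[of "c * d"] by simp
next
  case (add v w)
  then show ?case by (simp add: distrib_left J_even.add)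
next
  case (s w)
  have "J_scalar c * (J_s * w) = J_s * (J_scalar c * w)" by (simp add: J_scalar_left_commute)
  with s show ?case by (simp add: J_even.s)
next
  case (z w)
  have "J_scalar c * (J_z * w) = J_z * (J_scalar c * w)" by (simp add: J_scalar_left_commute)
  with z show ?case by (simp add: J_even.z)
qed

lemma J_even_uminus: "w \<in> J_even \<Longrightarrow> - w \<in> J_even"
  using J_even_scalar_mult[of w "- 1"] by (simp add: J_scalar_minus)

text \<open>From sx = xs and zx = x(z + s), a factor x on the right can be moved to the left. The
  purpose is that x w x = x x w' = 0, for which nothing about w' has to be known.\<close>

lemma J_even_x: "w \<in> J_even \<Longrightarrow> \<exists>w'. w * J_x = J_x * w'"
proof (induction rule: J_even.induct)
  case (scalar c)
  then show ?case by (metis J_scalar_central)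
next
  case (add v w)
  then show ?case by (metis distrib_left distrib_right)
next
  case (s w)
  then obtain w' where "w * J_x = J_x * w'" by auto
  then have "J_s * w * J_x = J_x * (J_s * w')" by (simp add: mult.assoc super_jordan_rewrite)
  then show ?case by auto
next
  case (z w)
  then obtain w' where "w * J_x = J_x * w'" by auto
  then have "J_z * w * J_x = J_x * (J_z * w' + J_s * w')"
    by (simp add: mult.assoc super_jordan_rewrite distrib_left)
  then show ?case by auto
qed

text \<open>The commutator with y vanishes on z and sends s to sx = xs, so it maps W into xW. A
  further factor x on the left kills it.\<close>

lemma J_even_y: "w \<in> J_even \<Longrightarrow> \<exists>w'\<in>J_even. J_y * w = w * J_y + J_x * w'"
proof (induction rule: J_even.induct)
  case (scalar c)
  have "J_y * J_scalar c = J_scalar c * J_y + J_x * 0" by (simp add: J_scalar_central)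
  then show ?case using J_even_0 by blast
next
  case (add v w)
  then obtain v' w' where "v' \<in> J_even" "J_y * v = v * J_y + J_x * v'"
    "w' \<in> J_even" "J_y * w = w * J_y + J_x * w'" by blast
  then have "v' + w' \<in> J_even" "J_y * (v + w) = (v + w) * J_y + J_x * (v' + w')"
    by (simp_all add: J_even.add algebra_simps)
  then show ?case by blast
next
  case (s w)
  then obtain w' where w': "w' \<in> J_even" "J_y * w = w * J_y + J_x * w'" by blast
  then have "J_y * (J_s * w) = J_s * w * J_y + J_x * (J_s * w' + J_s * w)"
    by (simp add: super_jordan_rewrite algebra_simps)
  moreover have "J_s * w' + J_s * w \<in> J_even" using w' s by (intro J_even.intros)
  ultimately show ?case by blast
next
  case (z w)
  then obtain w' where w': "w' \<in> J_even" "J_y * w = w * J_y + J_x * w'" by blast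
  then have "J_y * (J_z * w) = J_z * w * J_y + J_x * (J_z * w' + J_s * w')"
    by (simp add: super_jordan_rewrite algebra_simps)
  moreover have "J_z * w' + J_s * w' \<in> J_even" using w' by (intro J_even.intros)
  ultimately show ?case by blast
qed

lemma J_even_eval: "w \<in> J_even \<Longrightarrow> \<exists>P. w = eval_sz P"
proof (induction rule: J_even.induct)
  case (scalar c)
  have "J_scalar c = eval_sz [:[:c:]:]" by simp
  then show ?case by blast
next
  case (add v w)
  then show ?case by (metis eval_sz_simps(3))
next
  case (s w)
  then obtain P where "w = eval_sz P" by blast
  then have "J_s * w = eval_sz (pCons 0 P)" by simp
  then show ?case by blast
next
  case (z w)
  have "\<exists>Q. J_z * eval_sz P = eval_sz Q" for P :: "'a poly poly"
  proof (induction P)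
    case 0
    show ?case by (rule exI[of _ 0]) simp
  next
    case (pCons p P)
    then obtain Q where "J_z * eval_sz P = eval_sz Q" by blast
    \<comment> \<open>By zs = sz + s^2, z(p(z) + s f) = z p(z) + s(z f + s f).\<close>
    then have "J_z * eval_sz (pCons p P) = eval_sz (pCons (pCons 0 p) (Q + pCons 0 P))"
      by (simp add: algebra_simps super_jordan_rewrite)
    then show ?case by blast
  qed
  with z show ?case by blast
qed

section \<open>The decomposition J = W + xW + yW + xyW\<close>

definition J_decomposable :: "'k::field super_jordan \<Rightarrow> bool" where
  "J_decomposable a \<longleftrightarrow> (\<exists>w1\<in>J_even. \<exists>w2\<in>J_even. \<exists>w3\<in>J_even. \<exists>w4\<in>J_even.
     a = w1 + J_x * w2 + J_y * w3 + J_x * (J_y * w4))"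

lemma J_decomposableI:
  assumes "w1 \<in> J_even" "w2 \<in> J_even" "w3 \<in> J_even" "w4 \<in> J_even"
    and "a = w1 + J_x * w2 + J_y * w3 + J_x * (J_y * w4)"
  shows "J_decomposable a"
  using assms unfolding J_decomposable_def by blast

lemma J_decomposableE:
  assumes "J_decomposable a"
  obtains w1 w2 w3 w4 where "w1 \<in> J_even" "w2 \<in> J_even" "w3 \<in> J_even" "w4 \<in> J_even"
    "a = w1 + J_x * w2 + J_y * w3 + J_x * (J_y * w4)"
  using assms unfolding J_decomposable_def by blast

text \<open>The decomposable elements are stable under left multiplication by each generator, hence
  form a left ideal; it contains 1 and so is everything.\<close>

lemma J_decomposable_mult: "J_decomposable b \<Longrightarrow> J_decomposable (a * b)"
proof (induction a arbitrary: b rule: super_jordan_induct)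
  case (scalar c)
  from scalar obtain w1 w2 w3 w4 where w: "w1 \<in> J_even" "w2 \<in> J_even" "w3 \<in> J_even" "w4 \<in> J_even"
    "b = w1 + J_x * w2 + J_y * w3 + J_x * (J_y * w4)" by (rule J_decomposableE)
  show ?case
    by (rule J_decomposableI[OF w(1-4)[THEN J_even_scalar_mult, of c]])
      (simp add: w(5) distrib_left J_scalar_left_commute)
next
  case x
  from x obtain w1 w2 w3 w4 where w: "w1 \<in> J_even" "w2 \<in> J_even" "w3 \<in> J_even" "w4 \<in> J_even"
    "b = w1 + J_x * w2 + J_y * w3 + J_x * (J_y * w4)" by (rule J_decomposableE)
  show ?case
    by (rule J_decomposableI[of 0 w1 0 w3]) (simp_all add: w distrib_left super_jordan_rewrite)
next
  case y
  from y obtain w1 w2 w3 w4 where w: "w1 \<in> J_even" "w2 \<in> J_even" "w3 \<in> J_even" "w4 \<in> J_even"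
    "b = w1 + J_x * w2 + J_y * w3 + J_x * (J_y * w4)" by (rule J_decomposableE)
  \<comment> \<open>Witnesses from yx = s - xy and sy = ys - xs: y x w2 = s w2 - xy w2, y y w3 = z
    w3, and y xy w4 = y s w4 - x(z + s) w4.\<close>
  have "- (J_z * w4) - J_s * w4 \<in> J_even"
    using J_even.add[OF J_even_uminus[OF J_even.z] J_even_uminus[OF J_even.s], OF w(4) w(4)] by simp
  then show ?case
    by (intro J_decomposableI[of "J_s * w2 + J_z * w3" "- (J_z * w4) - J_s * w4" "w1 + J_s * w4" "- w2"])
      (simp_all add: w algebra_simps super_jordan_rewrite J_even.intros J_even_uminus)
next
  case (add a1 a2)
  from add(1)[OF add(3)] obtain u1 u2 u3 u4
    where u: "u1 \<in> J_even" "u2 \<in> J_even" "u3 \<in> J_even" "u4 \<in> J_even"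
    "a1 * b = u1 + J_x * u2 + J_y * u3 + J_x * (J_y * u4)" by (rule J_decomposableE)
  from add(2)[OF add(3)] obtain w1 w2 w3 w4
    where w: "w1 \<in> J_even" "w2 \<in> J_even" "w3 \<in> J_even" "w4 \<in> J_even"
    "a2 * b = w1 + J_x * w2 + J_y * w3 + J_x * (J_y * w4)" by (rule J_decomposableE)
  show ?case
    by (rule J_decomposableI[of "u1 + w1" "u2 + w2" "u3 + w3" "u4 + w4"])
      (simp_all add: u w J_even.add distrib_left distrib_right)
next
  case (mult a1 a2)
  then show ?case by (simp add: mult.assoc)
qed

lemma J_decomposable: "J_decomposable a"
proof -
  have "J_decomposable 1"
    by (rule J_decomposableI[of 1 0 0 0]) (use J_even.scalar[of 1] in auto)
  from J_decomposable_mult[OF this, of a] show ?thesis by simp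
qed

text \<open>The properties of the annihilator of a nonzero module on which s is bijective, isolated
  so that the remaining argument takes place inside J.\<close>

locale cancel_s_ideal =
  fixes I :: "'k::field_char_0 super_jordan set"
  assumes add: "a \<in> I \<Longrightarrow> b \<in> I \<Longrightarrow> a + b \<in> I"
    and mult_left: "a \<in> I \<Longrightarrow> b * a \<in> I"
    and mult_right: "a \<in> I \<Longrightarrow> a * b \<in> I"
    and one: "1 \<notin> I"
    and cancel_left: "J_s * a \<in> I \<Longrightarrow> a \<in> I"
    and cancel_right: "a * J_s \<in> I \<Longrightarrow> a \<in> I"
begin

lemma diff: "a \<in> I \<Longrightarrow> b \<in> I \<Longrightarrow> a - b \<in> I"
  using add[of a "- b"] mult_left[of b "- 1"] by simp

lemma scalar_eq_0: "J_scalar c \<in> I \<Longrightarrow> c = 0"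
  using mult_left[of "J_scalar c" "J_scalar (inverse c)"] one
  by (cases "c = 0") (simp_all flip: J_scalar_simps(4))

text \<open>The commutator of p(z) with s stays in the ideal and equals s p'(z) s; cancelling s on
  both sides leaves p'(z).\<close>

lemma eval_z_eq_0: "eval_z p \<in> I \<Longrightarrow> p = 0"
  unfolding eval_z_def
proof (rule horner_eq_0_of_pderiv[where I = I])
  fix p :: "'k poly" assume "horner J_scalar J_z p \<in> I"
  then have "eval_z p \<in> I" by (simp add: eval_z_def)
  from diff[OF mult_right mult_left, OF this this, of J_s J_s]
 have "J_s * (eval_z (pderiv p) * J_s) \<in> I" by (simp add: eval_z_commutator[of p])
  then show "horner J_scalar J_z (pderiv p) \<in> I"
    unfolding eval_z_def by (rule cancel_right[OF cancel_left])
qed (auto simp: scalar_eq_0)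

text \<open>Commuting with z leaves the derivative in s after two left cancellations. The constants
  of this differentiation are polynomials in z, which \<open>eval_z_eq_0\<close> handles.\<close>

lemma eval_sz_eq_0: "eval_sz P \<in> I \<Longrightarrow> P = 0"
  unfolding eval_sz_def
proof (rule horner_eq_0_of_pderiv[where I = I])
  fix P :: "'k poly poly" assume "horner eval_z J_s P \<in> I"
  then have "eval_sz P \<in> I" by (simp add: eval_sz_def)
  from diff[OF mult_left mult_right, OF this this, of J_z J_z]
 have "J_s * (J_s * eval_sz (pderiv P)) \<in> I" by (simp add: eval_sz_commutator[of P])
  then show "horner eval_z J_s (pderiv P) \<in> I"
    unfolding eval_sz_def by (rule cancel_left[OF cancel_left])
qed (auto simp: eval_z_eq_0)

lemma even_eq_0: "w \<in> J_even \<Longrightarrow> w \<in> I \<Longrightarrow> w = 0"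
  using J_even_eval[of w] eval_sz_eq_0 eval_sz_simps(1) by metis

text \<open>The anticommutator of wx with y is ws: the commutator of y and w lies in xW, and its
  product with x on the right vanishes, so y w x = w y x. Then s is cancelled on the right.\<close>

lemma cancel_x_right:
  assumes "w \<in> J_even" "w * J_x \<in> I" shows "w = 0"
proof -
  obtain w' where w': "w' \<in> J_even" "J_y * w = w * J_y + J_x * w'"
    using J_even_y[OF assms(1)] by blast
  obtain w'' where w'': "w' * J_x = J_x * w''" using J_even_x[OF w'(1)] by blast
  have "J_y * (w * J_x) = w * J_y * J_x + J_x * (w' * J_x)"
    by (simp only: w'(2) distrib_right flip: mult.assoc)
  also have "J_x * (w' * J_x) = 0" by (simp only: w'' super_jordan_rewrite)
  finally have "w * (J_y * J_x) = J_y * (w * J_x)" by (simp add: mult.assoc)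
  then have "w * J_x * J_y + J_y * (w * J_x) = w * J_s"
    by (simp add: J_s_def algebra_simps)
  moreover have "w * J_x * J_y + J_y * (w * J_x) \<in> I"
    using assms(2) by (intro add[OF mult_right mult_left])
  ultimately have "w \<in> I" using cancel_right by simp
  with assms(1) show ?thesis by (rule even_eq_0)
qed

text \<open>Mirror image of \<open>cancel_x_right\<close>: x y w = x w y because x x = 0, so the
  anticommutator of xw with y is sw.\<close>

lemma cancel_x_left:
  assumes "w \<in> J_even" "J_x * w \<in> I" shows "w = 0"
proof -
  obtain w' where w': "w' \<in> J_even" "J_y * w = w * J_y + J_x * w'"
    using J_even_y[OF assms(1)] by blast
  have "J_x * (J_y * w) = J_x * w * J_y + J_x * (J_x * w')"
    by (simp only: w'(2) distrib_left mult.assoc)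
  then have "J_x * w * J_y = J_x * (J_y * w)" by (simp add: super_jordan_rewrite)
  then have "J_x * w * J_y + J_y * (J_x * w) = J_s * w" by (simp add: J_s_def algebra_simps)
  moreover have "J_x * w * J_y + J_y * (J_x * w) \<in> I"
    using assms(2) by (intro add[OF mult_right mult_left])
  ultimately have "w \<in> I" using cancel_left by simp
  with assms(1) show ?thesis by (rule even_eq_0)
qed

text \<open>The components are removed in the order w3, w1, w4, w2. By xyx = sx and x w x = 0 for w
  in W, xax = s w3 x; once w3 is gone, xa = x w1; once w1 is gone too, ax = s w4 x; what remains is
  a = x w2.\<close>

theorem eq_0:
  assumes "a \<in> I" shows "a = 0"
proof -
  obtain w1 w2 w3 w4 where w: "w1 \<in> J_even" "w2 \<in> J_even" "w3 \<in> J_even" "w4 \<in> J_even"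
    and a: "a = w1 + J_x * w2 + J_y * w3 + J_x * (J_y * w4)"
    using J_decomposable by (rule J_decomposableE)
  obtain w1' w2' w3' w4' where w': "w1 * J_x = J_x * w1'" "w2 * J_x = J_x * w2'"
    "w3 * J_x = J_x * w3'" "w4 * J_x = J_x * w4'"
    using w[THEN J_even_x] by blast
  have "J_x * (a * J_x) = J_s * (w3 * J_x)"
    by (simp add: a w' algebra_simps super_jordan_rewrite)
  moreover have "J_x * (a * J_x) \<in> I" using assms by (rule mult_left[OF mult_right])
  ultimately have [simp]: "w3 = 0" using cancel_x_right[OF w(3)] cancel_left by simp
  have "J_x * a = J_x * w1" by (simp add: a algebra_simps super_jordan_rewrite)
  then have [simp]: "w1 = 0" using cancel_x_left[OF w(1)] mult_left[OF assms, of J_x] by simp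
  have "a * J_x = J_s * (w4 * J_x)" by (simp add: a w' algebra_simps super_jordan_rewrite)
  then have [simp]: "w4 = 0"
    using cancel_x_right[OF w(4)] cancel_left mult_right[OF assms, of J_x] by simp
  from assms have "J_x * w2 \<in> I" by (simp add: a)
  then have "w2 = 0" by (rule cancel_x_left[OF w(2)])
  then show ?thesis by (simp add: a)
qed

end


section \<open>Simple modules over the super Jordan plane\<close>

locale sjp_module = left_module sjp M
  for M :: "('k::field free_alg set, 'm, 'z) module_scheme" (structure)
begin

definition act :: "'k super_jordan \<Rightarrow> 'm \<Rightarrow> 'm" where
  "act a m = Rep_super_jordan a \<odot> m"

lemma smult_eq_act:
  assumes "r \<in> carrier sjp" shows "r \<odot> m = act (Abs_super_jordan r) m"
  using assms by (simp add: act_def Abs_super_jordan_inverse)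

lemma act_closed [simp, intro]: "m \<in> carrier M \<Longrightarrow> act a m \<in> carrier M"
  by (simp add: act_def smult_closed)

lemma act_simps [simp]:
  assumes "m \<in> carrier M"
  shows "act (a + b) m = act a m \<oplus> act b m"
    "m' \<in> carrier M \<Longrightarrow> act a (m \<oplus> m') = act a m \<oplus> act a m'"
    "act (a * b) m = act a (act b m)" "act 1 m = m"
  using assms
  by (simp_all add: act_def smult_l_distr smult_r_distr smult_assoc1 smult_one)

lemma act_zero_left [simp]: "m \<in> carrier M \<Longrightarrow> act 0 m = \<zero>"
  using act_simps(1)[of m 0 0] M.add.l_cancel_one[of "act 0 m" "act 0 m"] by simp

lemma act_zero_right [simp]: "act a \<zero> = \<zero>"
  using act_simps(2)[of \<zero> \<zero> a] M.add.l_cancel_one[of "act a \<zero>" "act a \<zero>"] by simp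

lemma act_minus [simp]: "m \<in> carrier M \<Longrightarrow> act (- a) m = \<ominus> act a m"
  using act_simps(1)[of m "- a" a] M.minus_equality[of "act (- a) m" "act a m"] by simp

lemma act_diff [simp]: "m \<in> carrier M \<Longrightarrow> act (a - b) m = act a m \<ominus> act b m"
  using act_simps(1)[of m a "- b"] by (simp add: a_minus_def)

lemma diff_eq_zero_iff:
  assumes "m \<in> carrier M" "m' \<in> carrier M" shows "m \<ominus> m' = \<zero> \<longleftrightarrow> m = m'"
  using assms M.add.inv_equality[of m "\<ominus> m'"] M.minus_minus
  by (metis M.a_inv_closed M.minus_equality M.r_neg a_minus_def)

lemma diff_self [simp]: "m \<in> carrier M \<Longrightarrow> m \<ominus> m = \<zero>"
  by (simp add: diff_eq_zero_iff)

lemma submoduleI_act: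
  assumes H: "H \<subseteq> carrier M" "\<zero> \<in> H" "\<And>m m'. m \<in> H \<Longrightarrow> m' \<in> H \<Longrightarrow> m \<oplus> m' \<in> H"
    and act: "\<And>a m. m \<in> H \<Longrightarrow> act a m \<in> H"
  shows "submodule H sjp M"
proof (intro submodule.intro subgroup.intro submodule_axioms.intro)
  fix m assume "m \<in> H"
  moreover from this have "act (- 1) m = \<ominus> m" using act_minus[of m 1] H(1) by auto
  ultimately show "inv\<^bsub>add_monoid M\<^esub> m \<in> H" using act[of m "- 1"] by (simp add: a_inv_def)
qed (use assms in \<open>auto simp: smult_eq_act\<close>)

lemma submoduleI_generators:
  assumes H: "H \<subseteq> carrier M" "\<zero> \<in> H" "\<And>m m'. m \<in> H \<Longrightarrow> m' \<in> H \<Longrightarrow> m \<oplus> m' \<in> H"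
    and gen: "\<And>c m. m \<in> H \<Longrightarrow> act (J_scalar c) m \<in> H" "\<And>m. m \<in> H \<Longrightarrow> act J_x m \<in> H"
      "\<And>m. m \<in> H \<Longrightarrow> act J_y m \<in> H"
  shows "submodule H sjp M"
proof (rule submoduleI_act[OF H])
  fix a m assume "m \<in> H"
  then show "act a m \<in> H"
  proof (induction a arbitrary: m rule: super_jordan_induct)
    case (add a b)
    then have "m \<in> carrier M" using H(1) by auto
    with add show ?case by (simp add: H(3))
  next
    case (mult a b)
    then have "m \<in> carrier M" using H(1) by auto
    with mult show ?case by simp
  qed (auto intro: gen)
qed

end

locale simple_sjp_module = sjp_module M
  for M :: "('k::field free_alg set, 'm, 'z) module_scheme" (structure) +
  assumes nontrivial: "carrier M \<noteq> {\<zero>}"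
    and submodule_trivial: "submodule H sjp M \<Longrightarrow> H = {\<zero>} \<or> H = carrier M"

lemma simple_sjp_moduleI: "simple_module sjp M \<Longrightarrow> simple_sjp_module M"
  by (simp add: simple_module_def simple_sjp_module_def simple_sjp_module_axioms_def sjp_module_def)

context sjp_module
begin

text \<open>Normality of s: sx = xs and sy = (y - x)s, so whatever s kills is mapped by x and y to
  vectors that s kills.\<close>

lemma submodule_kernel_s: "submodule {m \<in> carrier M. act J_s m = \<zero>} sjp M"
proof (rule submoduleI_generators)
  fix m assume m: "m \<in> {m \<in> carrier M. act J_s m = \<zero>}"
  have "act (J_s * J_x) m = act (J_x * J_s) m" by (simp only: super_jordan_rewrite)
  then show "act J_x m \<in> {m \<in> carrier M. act J_s m = \<zero>}" using m by auto
  have "J_s * J_y = J_y * J_s - J_x * (J_s :: 'k super_jordan)" by (simp add: super_jordan_rewrite)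
  then have "act (J_s * J_y) m = act (J_y * J_s - J_x * J_s) m" by simp
  then show "act J_y m \<in> {m \<in> carrier M. act J_s m = \<zero>}" using m by (auto simp: a_minus_def)
  fix c
  have "act (J_s * J_scalar c) m = act (J_scalar c * J_s) m" by (simp only: J_scalar_central)
  then show "act (J_scalar c) m \<in> {m \<in> carrier M. act J_s m = \<zero>}" using m by auto
qed auto

lemma submodule_image_s: "submodule (act J_s ` carrier M) sjp M"
proof (rule submoduleI_generators)
  fix m m' assume "m \<in> act J_s ` carrier M" "m' \<in> act J_s ` carrier M"
  then obtain n n' where "n \<in> carrier M" "n' \<in> carrier M" "m = act J_s n" "m' = act J_s n'" by auto
  then have "m \<oplus> m' = act J_s (n \<oplus> n')" "n \<oplus> n' \<in> carrier M" by simp_all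
  then show "m \<oplus> m' \<in> act J_s ` carrier M" by blast
next
  fix m assume "m \<in> act J_s ` carrier M"
  then obtain n where n: "n \<in> carrier M" "m = act J_s n" by auto
  have "act (J_x * J_s) n = act (J_s * J_x) n" by (simp only: super_jordan_rewrite)
  with n have "act J_x m = act J_s (act J_x n)" by simp
  with n show "act J_x m \<in> act J_s ` carrier M" by blast
  have "act (J_y * J_s) n = act (J_s * J_y + J_s * J_x) n" by (simp only: super_jordan_rewrite)
  with n have "act J_y m = act J_s (act J_y n \<oplus> act J_x n)" by simp
  with n show "act J_y m \<in> act J_s ` carrier M" by blast
  fix c
  have "act (J_scalar c * J_s) n = act (J_s * J_scalar c) n" by (simp only: J_scalar_central)
  with n have "act (J_scalar c) m = act J_s (act (J_scalar c) n)" by simp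
  with n show "act (J_scalar c) m \<in> act J_s ` carrier M" by blast
qed (auto intro: image_eqI[of _ _ \<zero>])

text \<open>The vector \<open>u\<close> spans the module and J acts on it through the character
  \<open>J_char\<close>. This is the common description of the modules \<open>sjp_simple\<close> and
  of the simple modules with s acting as 0, so that comparing them reduces to comparing spanning
  vectors.\<close>

definition line :: "'k \<Rightarrow> 'm \<Rightarrow> bool" where
  "line \<alpha> u \<longleftrightarrow> u \<in> carrier M \<and> u \<noteq> \<zero> \<and> carrier M = range (\<lambda>c. act (J_scalar c) u) \<and>
     (\<forall>a. act a u = act (J_scalar (J_char \<alpha> a)) u)"

end

context simple_sjp_module
begin

lemma s_zero_or_bij:
  "(\<forall>m\<in>carrier M. act J_s m = \<zero>) \<or> bij_betw (act J_s) (carrier M) (carrier M)"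
proof (rule disjCI)
  assume nbij: "\<not> bij_betw (act J_s) (carrier M) (carrier M)"
  show "\<forall>m\<in>carrier M. act J_s m = \<zero>"
  proof (rule ccontr)
    assume neq: "\<not> ?thesis"
    then have ker: "{m \<in> carrier M. act J_s m = \<zero>} = {\<zero>}"
      using submodule_trivial[OF submodule_kernel_s] by blast
    have "act J_s ` carrier M = carrier M"
      using submodule_trivial[OF submodule_image_s] neq by blast
    moreover have "inj_on (act J_s) (carrier M)"
    proof (rule inj_onI)
      fix m m' assume m: "m \<in> carrier M" "m' \<in> carrier M" "act J_s m = act J_s m'"
      have "act J_s (act (- 1) m') = act (- 1 * J_s) m'" using m by (simp del: act_minus flip: act_simps(3))
      then have "act J_s (m \<ominus> m') = act J_s m \<ominus> act J_s m'" using m by (simp add: a_minus_def)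
      then have "m \<ominus> m' \<in> {m \<in> carrier M. act J_s m = \<zero>}" using m by simp
      then have "m \<ominus> m' = \<zero>" unfolding ker by simp
      then show "m = m'" using m by (simp add: diff_eq_zero_iff)
    qed
    ultimately show False using nbij by (simp add: bij_betw_def)
  qed
qed

text \<open>If s acts as 0, then xy = -yx on the module and the kernel of x is stable under y. It
  contains the image of x because x^2 = 0; so x acts as 0 whether the kernel is everything or only
  zero.\<close>

lemma x_zero:
  assumes s: "\<forall>m\<in>carrier M. act J_s m = \<zero>" and m: "m \<in> carrier M"
  shows "act J_x m = \<zero>"
proof -
  have xx: "act J_x (act J_x m) = \<zero>" if "m \<in> carrier M" for m
    using that act_simps(3)[of m J_x J_x] by (simp add: super_jordan_rewrite del: act_simps(3))
  have "submodule {m \<in> carrier M. act J_x m = \<zero>} sjp M"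
  proof (rule submoduleI_generators)
    fix m assume m: "m \<in> {m \<in> carrier M. act J_x m = \<zero>}"
    with xx show "act J_x m \<in> {m \<in> carrier M. act J_x m = \<zero>}" by auto
    have "act (J_x * J_y) m = act (J_s - J_y * J_x) m" by (simp add: J_s_def del: act_simps)
    then show "act J_y m \<in> {m \<in> carrier M. act J_x m = \<zero>}" using m s by (auto simp: a_minus_def)
    fix c
    have "act (J_x * J_scalar c) m = act (J_scalar c * J_x) m" by (simp only: J_scalar_central)
    then show "act (J_scalar c) m \<in> {m \<in> carrier M. act J_x m = \<zero>}" using m by auto
  qed auto
  from submodule_trivial[OF this] show ?thesis using xx[OF m] m by blast
qed

end

section \<open>Eigenvectors of y when s acts as zero\<close>

lemma horner_commutes:
  assumes "h 0 = 0" "\<And>c. a * h c = h c * a"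
  shows "a * horner h a p = horner h a p * a"
proof (induction p)
  case (pCons c p)
  then show ?case
    by (simp add: assms distrib_left distrib_right mult.assoc flip: pCons.IH)
qed simp

lemma horner_smult:
  "horner J_scalar a (Polynomial.smult c p) = J_scalar c * horner J_scalar a p"
  by (induction p) (simp_all add: distrib_left J_scalar_left_commute)

context sjp_module
begin

text \<open>Linear factors are split off one at a time: with p = (T - \<alpha>) q, either q(y)v is a
  nonzero eigenvector for \<alpha>, or q(y)v = 0 and q has smaller degree. Algebraic closedness
  enters as the assumption that roots exist.\<close>

lemma horner_y_eigenvector:
  fixes p :: "'k poly"
  assumes "\<And>q :: 'k poly. degree q > 0 \<Longrightarrow> \<exists>\<alpha>. poly q \<alpha> = 0"
    and "p \<noteq> 0" "v \<in> carrier M" "v \<noteq> \<zero>" "act (horner J_scalar J_y p) v = \<zero>"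
  shows "\<exists>\<alpha>. \<exists>u\<in>carrier M. u \<noteq> \<zero> \<and> act J_y u = act (J_scalar \<alpha>) u"
  using assms(2,5)
proof (induction "degree p" arbitrary: p rule: less_induct)
  case less
  show ?case
  proof (cases "degree p = 0")
    case True
    then obtain c where c: "p = [:c:]" by (rule degree_eq_zeroE)
    with less.prems have "c \<noteq> 0" "act (J_scalar c) v = \<zero>" by simp_all
    then have "act (J_scalar (inverse c) * J_scalar c) v = \<zero>" using assms(3) by simp
    then have "v = \<zero>" using \<open>c \<noteq> 0\<close> assms(3) by (simp flip: J_scalar_simps(4))
    with assms(4) show ?thesis by simp
  next
    case False
    then obtain \<alpha> where "poly p \<alpha> = 0" using assms(1)[of p] by auto
    then obtain q where p: "p = [:- \<alpha>, 1:] * q" by (metis dvdE poly_eq_0_iff_dvd)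
    with less.prems have "q \<noteq> 0" by auto
    then have deg: "degree q < degree p" unfolding p by (subst degree_mult_eq) auto
    have "p = Polynomial.smult (- \<alpha>) q + pCons 0 q" by (simp add: p)
    then have "horner J_scalar J_y p = (J_y - J_scalar \<alpha>) * horner J_scalar J_y q"
      by (simp only: horner_add J_scalar_simps horner_smult)
        (simp add: J_scalar_minus algebra_simps)
    then have *: "act J_y (act (horner J_scalar J_y q) v)
        = act (J_scalar \<alpha>) (act (horner J_scalar J_y q) v)"
      using less.prems(2) assms(3) by (simp add: diff_eq_zero_iff)
    show ?thesis
    proof (cases "act (horner J_scalar J_y q) v = \<zero>")
      case True
      with less.hyps[OF deg \<open>q \<noteq> 0\<close>] show ?thesis by blast
    next
      case False
      with * assms(3) show ?thesis by blast
    qed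
  qed
qed

end

lemma (in simple_sjp_module) ex_y_eigenvector:
  assumes root: "\<And>q :: 'k poly. degree q > 0 \<Longrightarrow> \<exists>\<alpha>. poly q \<alpha> = 0"
    and s: "\<forall>m\<in>carrier M. act J_s m = \<zero>"
  shows "\<exists>\<alpha>. \<exists>u\<in>carrier M. u \<noteq> \<zero> \<and> act J_y u = act (J_scalar \<alpha>) u"
proof -
  obtain v where v: "v \<in> carrier M" "v \<noteq> \<zero>" using nontrivial M.zero_closed by blast
  let ?e = "horner J_scalar (J_y :: 'k super_jordan)"
  \<comment> \<open>The orbit starts at yv rather than v: if it contains v, the equation v = p(y) y
    v is a genuine relation, whereas p(y) v = v could be trivial.\<close>
  let ?H = "(\<lambda>p. act (?e p) (act J_y v)) ` UNIV"
  have "submodule ?H sjp M"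
  proof (rule submoduleI_generators)
    show "?H \<subseteq> carrier M" using v by auto
    show "\<zero> \<in> ?H" using v by (intro image_eqI[of _ _ 0]) auto
    fix m assume "m \<in> ?H"
    then obtain p where m: "m = act (?e p) (act J_y v)" by auto
    have "act J_x m = act (?e 0) (act J_y v)" using m v x_zero[OF s] by simp
    then show "act J_x m \<in> ?H" by blast
    have "act J_y m = act (?e (pCons 0 p)) (act J_y v)" using m v by simp
    then show "act J_y m \<in> ?H" by blast
    show "act (J_scalar c) m \<in> ?H" for c
    proof -
      have "act (J_scalar c) m = act (?e (Polynomial.smult c p)) (act J_y v)"
        using m v by (simp add: horner_smult)
      then show ?thesis by blast
    qed
    fix m' assume "m' \<in> ?H"
    then obtain p' where m': "m' = act (?e p') (act J_y v)" by auto
    have "m \<oplus> m' = act (?e (p + p')) (act J_y v)" using m m' v by (simp add: horner_add)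
    then show "m \<oplus> m' \<in> ?H" by blast
  qed
  then consider "?H = {\<zero>}" | "?H = carrier M" using submodule_trivial by blast
  then show ?thesis
  proof cases
    case 1
    have "act (?e 1) (act J_y v) \<in> ?H" by blast
    then have "act J_y v = act (J_scalar 0) v" using 1 v by (simp add: one_pCons)
    with v show ?thesis by blast
  next
    case 2
    then obtain p where p: "v = act (?e p) (act J_y v)" using v by blast
    have "?e p * J_y = J_y * ?e p" by (simp add: horner_commutes J_scalar_central)
    then have "act (J_y * ?e p) v = v" using p v by (metis act_simps(3))
    \<comment> \<open>The relation v = p(y) y v says that 1 - T p(T) kills v; the constant
      coefficient 1 makes this polynomial nonzero.\<close>
    moreover have "?e ([:1:] + Polynomial.smult (- 1) (pCons 0 p)) = 1 - J_y * ?e p"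
      by (simp only: horner_add J_scalar_simps horner_smult) (simp add: J_scalar_minus)
    ultimately have "act (?e ([:1:] + Polynomial.smult (- 1) (pCons 0 p))) v = \<zero>"
      using v by (simp add: diff_eq_zero_iff)
    moreover have "[:1:] + Polynomial.smult (- 1) (pCons 0 p) \<noteq> 0" by simp
    ultimately show ?thesis using horner_y_eigenvector[OF root _ v] by blast
  qed
qed

text \<open>On the eigenvector u each generator acts as its character value, and this property
  passes to products since scalars are central. Hence the multiples of u form a nonzero
  submodule.\<close>

lemma (in simple_sjp_module) ex_line:
  assumes root: "\<And>q :: 'k poly. degree q > 0 \<Longrightarrow> \<exists>\<alpha>. poly q \<alpha> = 0"
    and s: "\<forall>m\<in>carrier M. act J_s m = \<zero>"
  shows "\<exists>\<alpha> u. line \<alpha> u"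
proof -
  obtain \<alpha> u where u: "u \<in> carrier M" "u \<noteq> \<zero>" "act J_y u = act (J_scalar \<alpha>) u"
    using ex_y_eigenvector[OF assms] by blast
  have char: "act a u = act (J_scalar (J_char \<alpha> a)) u" for a
  proof (induction a rule: super_jordan_induct)
    case (mult a b)
    have "act (a * b) u = act (a * J_scalar (J_char \<alpha> b)) u" using mult u by simp
    also have "\<dots> = act (J_scalar (J_char \<alpha> b)) (act a u)"
      using u by (simp flip: J_scalar_central act_simps(3))
    also have "\<dots> = act (J_scalar (J_char \<alpha> b * J_char \<alpha> a)) u" using mult u by simp
    finally show ?case by (simp only: J_char_simps mult.commute)
  qed (use u x_zero[OF s] in auto)
  have "submodule (range (\<lambda>c. act (J_scalar c) u)) sjp M"
  proof (rule submoduleI_act)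
    show "\<zero> \<in> range (\<lambda>c. act (J_scalar c) u)" using u by (intro image_eqI[of _ _ 0]) auto
    fix m assume "m \<in> range (\<lambda>c. act (J_scalar c) u)"
    then obtain c where m: "m = act (J_scalar c) u" by auto
    have "act a m = act (J_scalar (c * J_char \<alpha> a)) u" for a
      using u char[of a] by (simp add: m) (metis J_scalar_central act_simps(3))
    then show "act a m \<in> range (\<lambda>c. act (J_scalar c) u)" for a by blast
    fix m' assume "m' \<in> range (\<lambda>c. act (J_scalar c) u)"
    then obtain c' where m': "m' = act (J_scalar c') u" by auto
    have "m \<oplus> m' = act (J_scalar (c + c')) u" using u by (simp add: m m')
    then show "m \<oplus> m' \<in> range (\<lambda>c. act (J_scalar c) u)" by blast
  qed (use u in auto)
  moreover have "u \<in> range (\<lambda>c. act (J_scalar c) u)" using u by (intro image_eqI[of _ _ 1]) auto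
  ultimately have "carrier M = range (\<lambda>c. act (J_scalar c) u)" using submodule_trivial u by blast
  with u char have "line \<alpha> u" by (simp add: line_def)
  then show ?thesis by blast
qed

section \<open>One-dimensional modules: dimension, simplicity, isomorphism\<close>

context sjp_module
begin

lemma finsum_underlying: "finsum (underlying_space M) = finsum M"
  by (simp add: finsum_def finprod_def fun_eq_iff underlying_space_def)

lemma is_finite_basis_underlying:
  "is_finite_basis (underlying_space M) B \<longleftrightarrow> finite B \<and> B \<subseteq> carrier M \<and>
     (\<forall>v\<in>carrier M. \<exists>!c. c \<in> B \<rightarrow>\<^sub>E UNIV \<and> v = (\<Oplus>b\<in>B. act (J_scalar (c b)) b))"
  unfolding is_finite_basis_def finsum_underlying
  by (simp add: underlying_space_def act_def Rep_generators)

context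
  fixes \<alpha> u assumes line: "line \<alpha> u"
begin

lemma line_u: "u \<in> carrier M" "u \<noteq> \<zero>"
  using line by (auto simp: line_def)

lemma line_act: "act a u = act (J_scalar (J_char \<alpha> a)) u"
  using line by (auto simp: line_def)

lemma line_carrier: "m \<in> carrier M \<longleftrightarrow> (\<exists>c. m = act (J_scalar c) u)"
  using line by (auto simp: line_def)

lemma line_scalar_inj: "act (J_scalar c) u = act (J_scalar d) u \<Longrightarrow> c = d"
proof (rule ccontr)
  assume eq: "act (J_scalar c) u = act (J_scalar d) u" and "c \<noteq> d"
  then have "act (J_scalar (inverse (c - d) * (c - d))) u = \<zero>"
    using line_u by (simp add: diff_eq_zero_iff del: left_inverse)
  with \<open>c \<noteq> d\<close> line_u show False by simp
qed

lemma line_act_any: "m \<in> carrier M \<Longrightarrow> act a m = act (J_scalar (J_char \<alpha> a)) m"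
  unfolding line_carrier using line_u line_act[of a] by (metis J_scalar_central act_simps(3))

lemma line_has_dimension: "has_dimension (underlying_space M) 1"
proof -
  have "\<exists>!c. c \<in> {u} \<rightarrow>\<^sub>E UNIV \<and> v = (\<Oplus>b\<in>{u}. act (J_scalar (c b)) b)"
    if v: "v \<in> carrier M" for v
  proof -
    have sum: "(\<Oplus>b\<in>{u}. act (J_scalar (c b)) b) = act (J_scalar (c u)) u" for c
      using line_u M.finsum_insert[of "{}" u "\<lambda>b. act (J_scalar (c b)) b"] by simp
    obtain d where d: "v = act (J_scalar d) u" using v line_carrier by blast
    show ?thesis unfolding sum
    proof (rule ex1I[of _ "\<lambda>b\<in>{u}. d"])
      fix c assume c: "c \<in> {u} \<rightarrow>\<^sub>E UNIV \<and> v = act (J_scalar (c u)) u"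
      then have "c u = d" using d line_scalar_inj by metis
      with c show "c = (\<lambda>b\<in>{u}. d)" by (auto simp: fun_eq_iff PiE_def extensional_def)
    qed (simp add: d)
  qed
  then have "is_finite_basis (underlying_space M) {u}"
    using line_u by (simp add: is_finite_basis_underlying)
  then show ?thesis unfolding has_dimension_def by (intro exI[of _ "{u}"]) simp
qed

lemma line_not_faithful: "\<not> faithful_module sjp M"
proof
  assume "faithful_module sjp M"
  moreover have "Rep_super_jordan (J_y - J_scalar \<alpha>) \<odot> m = \<zero>" if "m \<in> carrier M" for m
    using line_act_any[OF that, of "J_y - J_scalar \<alpha>"] that unfolding act_def[symmetric]
    by (simp del: act_diff)
  ultimately have "Rep_super_jordan (J_y - J_scalar \<alpha>) = \<zero>\<^bsub>sjp\<^esub>"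
    unfolding faithful_module_def using Rep_super_jordan by blast
  then have "J_y - J_scalar \<alpha> = 0"
    by (simp only: flip: Rep_super_jordan_simps(1)) (simp only: Rep_super_jordan_inject)
  \<comment> \<open>The character \<open>x \<mapsto> 0, y \<mapsto> \<alpha> + 1\<close> shows that \<open>y - \<alpha>\<close> is nonzero.\<close>
  then have "J_char (\<alpha> + 1) (J_y - J_scalar \<alpha>) = 0" by simp
  then show False by simp
qed

lemma line_simple: "simple_module sjp M"
  unfolding simple_module_def
proof (intro conjI allI impI)
  show "left_module sjp M" by (rule left_module_axioms)
  show "carrier M \<noteq> {\<zero>}" using line_u by blast
  fix H assume H: "submodule H sjp M"
  interpret H: submodule H sjp M by (rule H)
  show "H = {\<zero>} \<or> H = carrier M"
  proof (rule disjCI)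
    assume "H \<noteq> carrier M"
    have sub: "H \<subseteq> carrier M" using H.subset by simp
    show "H = {\<zero>}"
    proof (rule ccontr)
      assume "H \<noteq> {\<zero>}"
      then obtain m where m: "m \<in> H" "m \<noteq> \<zero>" using H.one_closed by auto
      then obtain c where c: "m = act (J_scalar c) u" using sub line_carrier by blast
      with m line_u have "c \<noteq> 0" by auto
      have "act (J_scalar d) u \<in> H" for d
      proof -
        have "act (J_scalar (d * inverse c)) m \<in> H"
          using m(1) unfolding act_def by (intro H.smult_closed) simp
        moreover have "act (J_scalar (d * inverse c)) m = act (J_scalar (d * inverse c * c)) u"
          using c line_u by (simp del: mult.assoc)
        ultimately show ?thesis using \<open>c \<noteq> 0\<close> by (simp del: J_scalar_simps(4) add: mult.assoc)
      qed
      then have "carrier M \<subseteq> H" by (auto simp: line_carrier)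
      with sub \<open>H \<noteq> carrier M\<close> show False by blast
    qed
  qed
qed

end

end

text \<open>The map sends c u to c v, where c is unique by \<open>line_scalar_inj\<close>; it is
  compatible with J because both modules carry the same character.\<close>

lemma line_isomorphic:
  fixes M :: "('k::field free_alg set, 'm, 'y) module_scheme"
    and N :: "('k free_alg set, 'n, 'z) module_scheme"
  assumes "sjp_module M" "sjp_module N" "sjp_module.line M \<alpha> u" "sjp_module.line N \<alpha> v"
  shows "module_isomorphic sjp M N"
proof -
  interpret M: sjp_module M by fact
  interpret N: sjp_module N by fact
  define f where "f m = N.act (J_scalar (THE c. m = M.act (J_scalar c) u)) v" for m
  have f: "f (M.act (J_scalar c) u) = N.act (J_scalar c) v" for c
  proof -
    have "(THE d. M.act (J_scalar c) u = M.act (J_scalar d) u) = c"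
      using M.line_scalar_inj[OF assms(3)] by (intro the_equality) auto
    then show ?thesis by (simp add: f_def)
  qed
  note u = M.line_u[OF assms(3)] and v = N.line_u[OF assms(4)]
  show ?thesis unfolding module_isomorphic_def
  proof (intro exI[of _ f] conjI ballI)
    show "bij_betw f (carrier M) (carrier N)"
    proof (rule bij_betwI')
      fix m m' assume "m \<in> carrier M" "m' \<in> carrier M"
      then obtain c c' where "m = M.act (J_scalar c) u" "m' = M.act (J_scalar c') u"
        using M.line_carrier[OF assms(3)] by blast
      then show "f m = f m' \<longleftrightarrow> m = m'" using f N.line_scalar_inj[OF assms(4)] by metis
    next
      fix m assume "m \<in> carrier M"
      then show "f m \<in> carrier N" using v by (simp add: f_def)
    next
      fix n assume "n \<in> carrier N"
      then obtain c where "n = N.act (J_scalar c) v" using N.line_carrier[OF assms(4)] by blast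
      then show "\<exists>m\<in>carrier M. n = f m" using f u by (metis M.act_closed)
    qed
    fix m assume "m \<in> carrier M"
    then obtain c where c: "m = M.act (J_scalar c) u" using M.line_carrier[OF assms(3)] by blast
    {
      fix m' assume "m' \<in> carrier M"
      then obtain c' where c': "m' = M.act (J_scalar c') u"
        using M.line_carrier[OF assms(3)] by blast
      have "m \<oplus>\<^bsub>M\<^esub> m' = M.act (J_scalar (c + c')) u" using u by (simp add: c c')
      then have "f (m \<oplus>\<^bsub>M\<^esub> m') = N.act (J_scalar (c + c')) v" by (simp only: f)
      then show "f (m \<oplus>\<^bsub>M\<^esub> m') = f m \<oplus>\<^bsub>N\<^esub> f m'" using v by (simp add: c c' f)
    }
    fix a assume a: "a \<in> carrier (sjp :: 'k free_alg set ring)"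
    define r where "r = Abs_super_jordan a"
    have "M.act r m = M.act (J_scalar (J_char \<alpha> r * c)) u"
      using u M.line_act_any[OF assms(3), of m r] by (simp add: c)
    then have "f (M.act r m) = N.act (J_scalar (J_char \<alpha> r * c)) v" by (simp only: f)
    also have "\<dots> = N.act r (f m)"
      using v N.line_act_any[OF assms(4), of "f m" r] by (simp add: c f)
    finally show "f (a \<odot>\<^bsub>M\<^esub> m) = a \<odot>\<^bsub>N\<^esub> f m"
      using a by (simp add: M.smult_eq_act N.smult_eq_act r_def)
  qed
qed


section \<open>Bijective action of the normal element\<close>

text \<open>The annihilator is an instance of \<open>cancel_s_ideal\<close>: injectivity of s allows
  cancellation of s on the left, surjectivity on the right.\<close>

lemma s_bij_imp_faithful:
  fixes M :: "('k::field_char_0 free_alg set, 'm, 'z) module_scheme"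
  assumes "sjp_module M" "carrier M \<noteq> {\<zero>\<^bsub>M\<^esub>}"
    and bij: "bij_betw (sjp_module.act M J_s) (carrier M) (carrier M)"
  shows "faithful_module sjp M"
proof -
  interpret sjp_module M by fact
  define I where "I = {a. \<forall>m\<in>carrier M. act a m = \<zero>\<^bsub>M\<^esub>}"
  have I: "a \<in> I \<Longrightarrow> m \<in> carrier M \<Longrightarrow> act a m = \<zero>\<^bsub>M\<^esub>" for a m
    by (simp add: I_def)
  interpret I: cancel_s_ideal I
  proof
    show "a + b \<in> I" if "a \<in> I" "b \<in> I" for a b using that by (simp add: I_def)
    show "b * a \<in> I" "a * b \<in> I" if "a \<in> I" for a b using that by (simp_all add: I_def)
    show "1 \<notin> I" using assms(2) M.zero_closed by (auto simp: I_def)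
  next
    fix a assume a: "J_s * a \<in> I"
    have "act a m = \<zero>\<^bsub>M\<^esub>" if m: "m \<in> carrier M" for m
    proof -
      have "act J_s (act a m) = act J_s \<zero>\<^bsub>M\<^esub>" using I[OF a m] m by simp
      then show ?thesis by (rule inj_onD[OF bij_betw_imp_inj_on[OF bij]]) (use m in auto)
    qed
    then show "a \<in> I" by (simp add: I_def)
  next
    fix a assume a: "a * J_s \<in> I"
    have "act a m = \<zero>\<^bsub>M\<^esub>" if m: "m \<in> carrier M" for m
    proof -
      obtain n where "n \<in> carrier M" "m = act J_s n" using bij m by (auto simp: bij_betw_def)
      then show ?thesis using I[OF a] by simp
    qed
    then show "a \<in> I" by (simp add: I_def)
  qed
  show ?thesis unfolding faithful_module_def
  proof (intro ballI impI)
    fix a assume a: "a \<in> carrier (sjp :: 'k free_alg set ring)" "\<forall>m\<in>carrier M. a \<odot>\<^bsub>M\<^esub> m = \<zero>\<^bsub>M\<^esub>"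
    then have "Abs_super_jordan a \<in> I" by (simp add: I_def smult_eq_act)
    then have "Abs_super_jordan a = 0" by (rule I.eq_0)
    then show "a = \<zero>\<^bsub>sjp\<^esub>" using a(1) by (metis Abs_super_jordan_inverse Rep_super_jordan_simps(1))
  qed
qed

section \<open>Coordinates and trace for a finite basis\<close>

context sjp_module
begin

definition linear_on :: "('m \<Rightarrow> 'm) \<Rightarrow> bool" where
  "linear_on f \<longleftrightarrow> f \<in> carrier M \<rightarrow> carrier M \<and>
     (\<forall>m\<in>carrier M. \<forall>m'\<in>carrier M. f (m \<oplus> m') = f m \<oplus> f m') \<and>
     (\<forall>c. \<forall>m\<in>carrier M. f (act (J_scalar c) m) = act (J_scalar c) (f m))"

lemma linear_onD:
  assumes "linear_on f" "m \<in> carrier M"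
  shows "f m \<in> carrier M" "m' \<in> carrier M \<Longrightarrow> f (m \<oplus> m') = f m \<oplus> f m'"
    "f (act (J_scalar c) m) = act (J_scalar c) (f m)"
  using assms by (auto simp: linear_on_def)

lemma linear_on_act: "(\<And>c. a * J_scalar c = J_scalar c * a) \<Longrightarrow> linear_on (act a)"
  unfolding linear_on_def by (auto simp flip: act_simps(3))

context
  fixes B assumes basis: "is_finite_basis (underlying_space M) B"
begin

definition coord :: "'m \<Rightarrow> 'm \<Rightarrow> 'k" where
  "coord m = (THE c. c \<in> B \<rightarrow>\<^sub>E UNIV \<and> m = (\<Oplus>b\<in>B. act (J_scalar (c b)) b))"

lemma B_finite: "finite B" and B_carrier: "B \<subseteq> carrier M"
  using basis by (auto simp: is_finite_basis_underlying)

lemma coord_expansion: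
  assumes "m \<in> carrier M"
  shows "coord m \<in> B \<rightarrow>\<^sub>E UNIV" "m = (\<Oplus>b\<in>B. act (J_scalar (coord m b)) b)"
proof -
  have "\<exists>!c. c \<in> B \<rightarrow>\<^sub>E UNIV \<and> m = (\<Oplus>b\<in>B. act (J_scalar (c b)) b)"
    using basis assms by (simp add: is_finite_basis_underlying)
  from theI'[OF this, folded coord_def]
  show "coord m \<in> B \<rightarrow>\<^sub>E UNIV" "m = (\<Oplus>b\<in>B. act (J_scalar (coord m b)) b)" by auto
qed

lemma expansion_cong:
  assumes "A \<subseteq> carrier M" "\<And>b. b \<in> A \<Longrightarrow> c b = d b"
  shows "(\<Oplus>b\<in>A. act (J_scalar (c b)) b) = (\<Oplus>b\<in>A. act (J_scalar (d b)) b)"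
  using assms by (intro M.finsum_cong') auto

text \<open>Uniqueness in the definition of a basis concerns families that are extensional on B. A
  family with arbitrary values elsewhere is first restricted, which does not change the sum.\<close>

lemma coord_unique:
  assumes "m = (\<Oplus>b\<in>B. act (J_scalar (c b)) b)" "b \<in> B"
  shows "coord m b = c b"
proof -
  have m: "m \<in> carrier M" unfolding assms(1) using B_carrier by (intro M.finsum_closed) auto
  have "m = (\<Oplus>b\<in>B. act (J_scalar (restrict c B b)) b)"
    unfolding assms(1) using B_carrier by (intro expansion_cong) auto
  then have "restrict c B \<in> B \<rightarrow>\<^sub>E UNIV \<and> m = (\<Oplus>b\<in>B. act (J_scalar (restrict c B b)) b)"
    by simp
  moreover have "\<exists>!c. c \<in> B \<rightarrow>\<^sub>E UNIV \<and> m = (\<Oplus>b\<in>B. act (J_scalar (c b)) b)"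
    using basis m by (simp add: is_finite_basis_underlying)
  ultimately have "coord m = restrict c B" unfolding coord_def by (intro the1_equality)
  then show ?thesis using assms(2) by simp
qed

lemma coord_add:
  assumes "m \<in> carrier M" "m' \<in> carrier M" "b \<in> B"
  shows "coord (m \<oplus> m') b = coord m b + coord m' b"
proof (rule coord_unique[OF _ assms(3)])
  have "m \<oplus> m' = (\<Oplus>b\<in>B. act (J_scalar (coord m b)) b) \<oplus> (\<Oplus>b\<in>B. act (J_scalar (coord m' b)) b)"
    by (rule arg_cong2[OF coord_expansion(2)[OF assms(1)] coord_expansion(2)[OF assms(2)]])
  also have "\<dots> = (\<Oplus>b\<in>B. act (J_scalar (coord m b)) b \<oplus> act (J_scalar (coord m' b)) b)"
    using B_carrier by (subst M.finsum_addf) auto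
  also have "\<dots> = (\<Oplus>b\<in>B. act (J_scalar (coord m b + coord m' b)) b)"
    using B_carrier by (intro M.finsum_cong') (auto simp: subset_iff)
  finally show "m \<oplus> m' = (\<Oplus>b\<in>B. act (J_scalar (coord m b + coord m' b)) b)" .
qed

lemma act_scalar_expansion:
  assumes "finite A" "A \<subseteq> carrier M"
  shows "act (J_scalar d) (\<Oplus>b\<in>A. act (J_scalar (c b)) b) = (\<Oplus>b\<in>A. act (J_scalar (d * c b)) b)"
  using assms
proof (induction A rule: finite_induct)
  case (insert b A)
  then have "(\<lambda>b. act (J_scalar (e b)) b) \<in> A \<rightarrow> carrier M" for e by auto
  moreover have "act (J_scalar d) (act (J_scalar (c b)) b) = act (J_scalar (d * c b)) b"
    using insert by simp
  ultimately show ?case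
    using insert by (simp add: M.finsum_insert M.finsum_closed del: J_scalar_simps(4))
qed simp

lemma coord_scalar:
  assumes "m \<in> carrier M" "b \<in> B"
  shows "coord (act (J_scalar d) m) b = d * coord m b"
  using coord_expansion(2)[OF assms(1)] act_scalar_expansion[OF B_finite B_carrier, of d "coord m"]
  by (intro coord_unique[OF _ assms(2)]) simp

lemma coord_zero: "b \<in> B \<Longrightarrow> coord \<zero> b = 0"
  using coord_scalar[of \<zero> b 0] by simp

text \<open>The matrix form of f. The induction runs over finite subsets A because f is only
  additive in two arguments and has to be moved through the sum one vector at a time.\<close>

lemma coord_linear:
  assumes f: "linear_on f" and m: "m \<in> carrier M" and b': "b' \<in> B"
  shows "coord (f m) b' = (\<Sum>b\<in>B. coord m b * coord (f b) b')"
proof -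
  have "coord (f (\<Oplus>b\<in>A. act (J_scalar (c b)) b)) b' = (\<Sum>b\<in>A. c b * coord (f b) b')"
    if "finite A" "A \<subseteq> carrier M" for A c
    using that
  proof (induction A rule: finite_induct)
    case empty
    have "f (act (J_scalar 0) \<zero>) = \<zero>"
      using linear_onD(1)[OF f, of \<zero>] linear_onD(3)[OF f, of \<zero> 0] by simp
    then show ?case using b' by (simp add: coord_zero)
  next
    case (insert b A)
    then have closed: "(\<lambda>b. act (J_scalar (c b)) b) \<in> A \<rightarrow> carrier M" by auto
    from insert have b: "b \<in> carrier M" by simp
    have "f (\<Oplus>b\<in>insert b A. act (J_scalar (c b)) b)
        = act (J_scalar (c b)) (f b) \<oplus> f (\<Oplus>b\<in>A. act (J_scalar (c b)) b)"
      using insert closed b linear_onD[OF f] by (simp add: M.finsum_insert M.finsum_closed)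
    then show ?case
      using insert closed b b' linear_onD(1)[OF f]
      by (simp add: coord_add coord_scalar M.finsum_closed)
  qed
  from this[OF B_finite B_carrier, of "coord m"] show ?thesis
    using coord_expansion(2)[OF m] by simp
qed

definition trace :: "('m \<Rightarrow> 'm) \<Rightarrow> 'k" where
  "trace f = (\<Sum>b\<in>B. coord (f b) b)"

lemma trace_commute:
  assumes "linear_on f" "linear_on g"
  shows "trace (\<lambda>m. f (g m)) = trace (\<lambda>m. g (f m))"
proof -
  have "trace (\<lambda>m. f (g m)) = (\<Sum>b\<in>B. \<Sum>b'\<in>B. coord (g b) b' * coord (f b') b)"
    unfolding trace_def using B_carrier linear_onD(1)[OF assms(2)]
    by (intro sum.cong refl coord_linear[OF assms(1)]) auto
  also have "\<dots> = (\<Sum>b'\<in>B. \<Sum>b\<in>B. coord (f b') b * coord (g b) b')"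
    by (subst sum.swap) (simp add: mult.commute)
  also have "\<dots> = trace (\<lambda>m. g (f m))"
    unfolding trace_def using B_carrier linear_onD(1)[OF assms(1)]
    by (intro sum.cong refl coord_linear[OF assms(2), symmetric]) auto
  finally show ?thesis .
qed

lemma coord_basis: "b \<in> B \<Longrightarrow> coord b b = 1"
proof -
  assume b: "b \<in> B"
  have "(\<Oplus>b'\<in>B. act (J_scalar (if b' = b then 1 else 0)) b') = (\<Oplus>b'\<in>B. if b = b' then b' else \<zero>)"
    using B_carrier by (intro M.finsum_cong') auto
  also have "\<dots> = b" using B_finite B_carrier b by (intro M.finsum_singleton) auto
  finally show "coord b b = 1" using coord_unique[of b "\<lambda>b'. if b' = b then 1 else 0" b] b by simp
qed

end

end

text \<open>
  With \<open>t\<close> the inverse of \<open>s\<close> and \<open>z = y\<^sup>2\<close>, the relation \<open>zs - sz = s\<^sup>2\<close> becomes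
  \<open>tz - zt = 1\<close>, and the trace of a commutator vanishes.
\<close>

lemma s_bij_imp_infinite_dimensional:
  fixes M :: "('k::field_char_0 free_alg set, 'm, 'z) module_scheme"
  assumes "sjp_module M" "carrier M \<noteq> {\<zero>\<^bsub>M\<^esub>}"
    and bij: "bij_betw (sjp_module.act M J_s) (carrier M) (carrier M)"
  shows "\<not> finite_dimensional (underlying_space M)"
proof
  interpret sjp_module M by fact
  assume "finite_dimensional (underlying_space M)"
  then obtain B where B: "is_finite_basis (underlying_space M) B"
    by (auto simp: finite_dimensional_def has_dimension_def)
  define t where "t = inv_into (carrier M) (act J_s)"
  have t: "t m \<in> carrier M" "act J_s (t m) = m" "t (act J_s m) = m" if "m \<in> carrier M" for m
    using that bij by (auto simp: t_def bij_betw_def inv_into_into f_inv_into_f)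
  have t_eqI: "t m = n" if "m \<in> carrier M" "n \<in> carrier M" "m = act J_s n" for m n
    using that t by simp
  have lin_t: "linear_on t"
    unfolding linear_on_def
  proof (intro conjI ballI allI)
    fix c m assume m: "m \<in> carrier M"
    have "act (J_s * J_scalar c) (t m) = act (J_scalar c * J_s) (t m)" by (simp add: J_scalar_central)
    then show "t (act (J_scalar c) m) = act (J_scalar c) (t m)" using m t by (intro t_eqI) simp_all
  qed (auto intro: t_eqI simp: t)
  have lin_z: "linear_on (act J_z)" by (intro linear_on_act) (simp add: J_scalar_central)
  have comm: "t (act J_z m) = act J_z (t m) \<oplus>\<^bsub>M\<^esub> m" if m: "m \<in> carrier M" for m
  proof (rule t_eqI)
    have "act (J_z * J_s) (t m) = act (J_s * J_z + J_s * J_s) (t m)"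
      by (simp only: super_jordan_rewrite)
    then show "act J_z m = act J_s (act J_z (t m) \<oplus>\<^bsub>M\<^esub> m)" using m t by simp
  qed (use m t in auto)
  note BM = B_carrier[OF B]
  have "trace B (\<lambda>m. t (act J_z m)) = trace B (\<lambda>m. act J_z (t m)) + of_nat (card B)"
  proof -
    have "coord B (t (act J_z b)) b = coord B (act J_z (t b)) b + 1" if "b \<in> B" for b
      using that BM t by (simp add: comm coord_add[OF B] coord_basis[OF B] subset_iff)
    then show ?thesis by (simp add: trace_def[OF B] sum.distrib)
  qed
  \<comment> \<open>The identity has trace \<open>card B\<close>, so the commutator relation makes
    this number 0 in the field; in characteristic 0 the basis is then empty, against M being
    nonzero.\<close>
  with trace_commute[OF B lin_t lin_z] have "card B = 0" by simp
  with B_finite[OF B] have "B = {}" by simp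
  with coord_expansion(2)[OF B] have "carrier M \<subseteq> {\<zero>\<^bsub>M\<^esub>}" by auto
  with assms(2) show False by auto
qed

section \<open>The one-dimensional modules\<close>

lemma left_module_quotient:
  assumes "ideal I R" shows "left_module R (quotient_module R I)"
proof -
  interpret ideal I R by fact
  interpret Q: ring "R Quot I" by (rule quotient_is_ring)
  have hom: "(+>\<^bsub>R\<^esub>) I \<in> ring_hom R (R Quot I)" by (rule rcos_ring_hom)
  note simps = ring_hom_closed[OF hom] ring_hom_add[OF hom] ring_hom_mult[OF hom] ring_hom_one[OF hom]
  show ?thesis
  proof (intro left_module.intro left_module_axioms.intro)
    show "abelian_group (quotient_module R I)"
    proof (rule abelian_groupI)
      fix x assume "x \<in> carrier (quotient_module R I)"
      then have "\<ominus>\<^bsub>R Quot I\<^esub> x \<in> carrier (quotient_module R I)"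
        "\<ominus>\<^bsub>R Quot I\<^esub> x \<oplus>\<^bsub>quotient_module R I\<^esub> x = \<zero>\<^bsub>quotient_module R I\<^esub>"
        by (simp_all add: quotient_module_def Q.l_neg)
      then show "\<exists>y\<in>carrier (quotient_module R I).
          y \<oplus>\<^bsub>quotient_module R I\<^esub> x = \<zero>\<^bsub>quotient_module R I\<^esub>" by blast
    qed (simp_all add: quotient_module_def Q.a_ac)
  qed (auto simp: quotient_module_def simps Q.l_distr Q.r_distr Q.m_assoc ring_axioms)
qed

text \<open>Modulo the three generators every element is congruent to the scalar given by its
  character, since this holds for x and y and passes to sums and products. So the class of 1 spans
  the quotient.\<close>

lemma sjp_simple_line:
  fixes \<alpha> :: "'k::field"
  shows "sjp_module (sjp_simple \<alpha>)" "\<exists>u. sjp_module.line (sjp_simple \<alpha>) \<alpha> u"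
proof -
  let ?G = "{sjp_s, sjp_x, sjp_y \<ominus>\<^bsub>sjp\<^esub> sjp_scalar \<alpha>}"
  define I where "I = Idl\<^bsub>sjp\<^esub> ?G"
  have gens: "?G = Rep_super_jordan ` {J_s, J_x, J_y - J_scalar \<alpha>}"
    by (simp add: Rep_generators)
  then have G: "?G \<subseteq> carrier sjp" by (auto simp del: Rep_super_jordan_simps)
  interpret I: ideal I sjp unfolding I_def by (rule sjp.genideal_ideal[OF G])
  interpret Q: ring "sjp Quot I" by (rule I.quotient_is_ring)
  have S: "sjp_simple \<alpha> = quotient_module sjp I" by (simp add: sjp_simple_def I_def)
  show module: "sjp_module (sjp_simple \<alpha>)"
    unfolding S sjp_module_def by (rule left_module_quotient) (rule I.ideal_axioms)
  interpret sjp_module "sjp_simple \<alpha>" by (rule module)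
  have hom: "(+>\<^bsub>sjp\<^esub>) I \<in> ring_hom sjp (sjp Quot I)" by (rule I.rcos_ring_hom)
  have gen: "Rep_super_jordan a \<in> I" if "a \<in> {J_s, J_x, J_y - J_scalar \<alpha>}" for a
    unfolding I_def using sjp.genideal_self[OF G] that gens by (auto simp del: Rep_super_jordan_simps)
  have scalar: "Rep_super_jordan (a - J_scalar (J_char \<alpha> a)) \<in> I" for a
  proof (induction a rule: super_jordan_induct)
    case (scalar c)
    then show ?case by simp
  next
    case x
    then show ?case using gen[of J_x] by (simp del: Rep_super_jordan_simps)
  next
    case y
    then show ?case using gen[of "J_y - J_scalar \<alpha>"] by (simp del: Rep_super_jordan_simps)
  next
    case (add a b)
    have "a + b - J_scalar (J_char \<alpha> (a + b))
        = (a - J_scalar (J_char \<alpha> a)) + (b - J_scalar (J_char \<alpha> b))" by simp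
    then show ?case using I.a_closed[OF add] by (simp only: Rep_super_jordan_simps(3))
  next
    case (mult a b)
    have "a * b - J_scalar (J_char \<alpha> (a * b))
        = (a - J_scalar (J_char \<alpha> a)) * b + J_scalar (J_char \<alpha> a) * (b - J_scalar (J_char \<alpha> b))"
      by (simp add: algebra_simps)
    then show ?case
      using I.a_closed[OF I.I_r_closed[OF mult(1) Rep_carrier] I.I_l_closed[OF mult(2) Rep_carrier]]
      by (simp only: Rep_super_jordan_simps(3,4))
  qed
  have coset: "I +>\<^bsub>sjp\<^esub> Rep_super_jordan a = I +>\<^bsub>sjp\<^esub> Rep_super_jordan (J_scalar (J_char \<alpha> a))" for a
    using scalar[of a] sjp.quotient_eq_iff_same_a_r_cos[OF I.ideal_axioms Rep_carrier Rep_carrier]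
    by (simp only: Rep_super_jordan_simps(6))
  define u where "u = I +>\<^bsub>sjp\<^esub> \<one>\<^bsub>sjp\<^esub>"
  have act_u: "act a u = I +>\<^bsub>sjp\<^esub> Rep_super_jordan a" for a
    using ring_hom_mult[OF hom, of "Rep_super_jordan a" "\<one>\<^bsub>sjp\<^esub>"]
    unfolding act_def by (simp add: S quotient_module_def u_def)
  have carrier: "carrier (sjp_simple \<alpha>) = range (\<lambda>a. act a u)"
  proof -
    have "carrier (sjp_simple \<alpha>) = (+>\<^bsub>sjp\<^esub>) I ` carrier sjp"
      by (auto simp: S quotient_module_def FactRing_def A_RCOSETS_def')
    also have "carrier sjp = range (Rep_super_jordan :: 'k super_jordan \<Rightarrow> _)"
      using type_definition.Rep_range[OF type_definition_super_jordan] by auto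
    finally show ?thesis by (auto simp: act_u)
  qed
  \<comment> \<open>Properness: the kernel of the character is an ideal that contains the three
    generators but not 1.\<close>
  have "\<one>\<^bsub>sjp\<^esub> \<notin> I"
  proof -
    have "ideal {r \<in> carrier sjp. J_char \<alpha> (Abs_super_jordan r) = 0} sjp"
    proof (rule idealI[OF sjp.ring_axioms])
      have add: "J_char \<alpha> (Abs_super_jordan (r \<oplus>\<^bsub>sjp\<^esub> r'))
          = J_char \<alpha> (Abs_super_jordan r) + J_char \<alpha> (Abs_super_jordan r')"
        and mult: "J_char \<alpha> (Abs_super_jordan (r \<otimes>\<^bsub>sjp\<^esub> r'))
          = J_char \<alpha> (Abs_super_jordan r) * J_char \<alpha> (Abs_super_jordan r')"
        if "r \<in> carrier sjp" "r' \<in> carrier sjp" for r r'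
        using that J_char_simps(1,2)[of \<alpha> "Abs_super_jordan r" "Abs_super_jordan r'"]
        by (simp_all add: plus_super_jordan_def times_super_jordan_def Abs_super_jordan_inverse)
      have zero: "J_char \<alpha> (Abs_super_jordan \<zero>\<^bsub>sjp\<^esub>) = 0"
        by (simp flip: zero_super_jordan_def)
      show "subgroup {r \<in> carrier sjp. J_char \<alpha> (Abs_super_jordan r) = 0} (add_monoid sjp)"
      proof (rule subgroup.intro)
        fix r assume r: "r \<in> {r \<in> carrier sjp. J_char \<alpha> (Abs_super_jordan r) = 0}"
        then have "J_char \<alpha> (Abs_super_jordan (\<ominus>\<^bsub>sjp\<^esub> r)) = 0"
          using add[of r "\<ominus>\<^bsub>sjp\<^esub> r"] zero by (simp add: sjp.r_neg)
        with r show "inv\<^bsub>add_monoid sjp\<^esub> r \<in> {r \<in> carrier sjp. J_char \<alpha> (Abs_super_jordan r) = 0}"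
          unfolding a_inv_def[symmetric] by auto
      qed (auto simp: add zero)
      show "r' \<otimes>\<^bsub>sjp\<^esub> r \<in> {r \<in> carrier sjp. J_char \<alpha> (Abs_super_jordan r) = 0}"
        "r \<otimes>\<^bsub>sjp\<^esub> r' \<in> {r \<in> carrier sjp. J_char \<alpha> (Abs_super_jordan r) = 0}"
        if "r \<in> {r \<in> carrier sjp. J_char \<alpha> (Abs_super_jordan r) = 0}" "r' \<in> carrier sjp" for r r'
        using that by (auto simp: mult)
    qed
    then have "I \<subseteq> {r \<in> carrier sjp. J_char \<alpha> (Abs_super_jordan r) = 0}"
      unfolding I_def
    proof (rule sjp.genideal_minimal)
      show "?G \<subseteq> {r \<in> carrier sjp. J_char \<alpha> (Abs_super_jordan r) = 0}"
        unfolding gens by (auto simp: Rep_super_jordan_inverse simp del: Rep_super_jordan_simps)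
    qed
    moreover have "J_char \<alpha> (Abs_super_jordan \<one>\<^bsub>sjp\<^esub>) = 1"
      by (simp flip: one_super_jordan_def)
    ultimately show ?thesis by auto
  qed
  then have "u \<noteq> \<zero>\<^bsub>sjp_simple \<alpha>\<^esub>"
    using sjp.quotient_eq_iff_same_a_r_cos[OF I.ideal_axioms sjp.one_closed sjp.zero_closed]
      ring_hom_zero[OF hom sjp.ring_axioms Q.ring_axioms]
    by (simp add: u_def S quotient_module_def a_minus_def)
  moreover have "u \<in> carrier (sjp_simple \<alpha>)"
    using ring_hom_closed[OF hom] by (simp add: u_def S quotient_module_def)
  moreover have "act a u = act (J_scalar (J_char \<alpha> a)) u" for a
    unfolding act_u by (rule coset)
  moreover from this have "carrier (sjp_simple \<alpha>) = range (\<lambda>c. act (J_scalar c) u)"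
    unfolding carrier by (auto simp: image_iff)
  ultimately have "line \<alpha> u" unfolding line_def by blast
  then show "\<exists>u. line \<alpha> u" by blast
qed


section \<open>Localization through a faithful module\<close>

text \<open>
  Since \<open>s\<close> acts bijectively on the faithful module \<open>M\<close>, the fraction \<open>s^(-n) a\<close> is determined by
  its action \<open>m \<mapsto> s^(-n) (a m)\<close>, and the ring axioms of the localization are inherited from
  the endomorphisms of \<open>M\<close>.
\<close>

locale localizing_module = left_module R M
  for R :: "('r, 'a) ring_scheme" and M :: "('r, 'm, 'z) module_scheme" +
  fixes s :: 'r
  assumes s_closed [simp]: "s \<in> carrier R"
    and s_normal: "a \<in> carrier R \<Longrightarrow> \<exists>a'\<in>carrier R. s \<otimes>\<^bsub>R\<^esub> a = a' \<otimes>\<^bsub>R\<^esub> s"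
    and s_bij: "bij_betw (\<lambda>m. s \<odot>\<^bsub>M\<^esub> m) (carrier M) (carrier M)"
    and faithful: "faithful_module R M"
begin

abbreviation L where "L \<equiv> localization R s"

definition t :: "'m \<Rightarrow> 'm" where
  "t = inv_into (carrier M) (\<lambda>m. s \<odot>\<^bsub>M\<^esub> m)"

declare smult_closed [simp, intro]

lemma t_simps [simp]:
  assumes "m \<in> carrier M"
  shows "t m \<in> carrier M" "s \<odot>\<^bsub>M\<^esub> t m = m" "t (s \<odot>\<^bsub>M\<^esub> m) = m"
  using assms s_bij by (auto simp: t_def bij_betw_def inv_into_into f_inv_into_f)

lemma t_funpow_closed [simp]: "m \<in> carrier M \<Longrightarrow> (t ^^ n) m \<in> carrier M"
  by (induction n) simp_all

lemma smult_zero_right [simp]: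
  assumes "a \<in> carrier R" shows "a \<odot>\<^bsub>M\<^esub> \<zero>\<^bsub>M\<^esub> = \<zero>\<^bsub>M\<^esub>"
  using smult_r_distr[OF assms M.zero_closed M.zero_closed]
    M.add.l_cancel_one[of "a \<odot>\<^bsub>M\<^esub> \<zero>\<^bsub>M\<^esub>" "a \<odot>\<^bsub>M\<^esub> \<zero>\<^bsub>M\<^esub>"] assms by simp

lemma smult_zero_left [simp]:
  assumes "m \<in> carrier M" shows "\<zero>\<^bsub>R\<^esub> \<odot>\<^bsub>M\<^esub> m = \<zero>\<^bsub>M\<^esub>"
  using smult_l_distr[OF R.zero_closed R.zero_closed assms]
    M.add.l_cancel_one[of "\<zero>\<^bsub>R\<^esub> \<odot>\<^bsub>M\<^esub> m" "\<zero>\<^bsub>R\<^esub> \<odot>\<^bsub>M\<^esub> m"] assms by simp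

lemma t_eqI: "m \<in> carrier M \<Longrightarrow> n \<in> carrier M \<Longrightarrow> m = s \<odot>\<^bsub>M\<^esub> n \<Longrightarrow> t m = n"
  by simp

lemma t_add:
  assumes "m \<in> carrier M" "m' \<in> carrier M" shows "t (m \<oplus>\<^bsub>M\<^esub> m') = t m \<oplus>\<^bsub>M\<^esub> t m'"
  using assms by (intro t_eqI) (simp_all add: smult_r_distr)

lemma t_funpow_add:
  assumes "m \<in> carrier M" "m' \<in> carrier M"
  shows "(t ^^ n) (m \<oplus>\<^bsub>M\<^esub> m') = (t ^^ n) m \<oplus>\<^bsub>M\<^esub> (t ^^ n) m'"
  using assms by (induction n) (simp_all add: t_add)

lemma t_funpow_zero: "(t ^^ n) \<zero>\<^bsub>M\<^esub> = \<zero>\<^bsub>M\<^esub>"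
  by (induction n) (simp_all add: t_eqI)

lemma s_pow_t [simp]: "m \<in> carrier M \<Longrightarrow> (s [^]\<^bsub>R\<^esub> n) \<odot>\<^bsub>M\<^esub> ((t ^^ n) m) = m" for n :: nat
  by (induction n) (simp_all add: smult_one smult_assoc1)

lemma t_s_pow [simp]: "m \<in> carrier M \<Longrightarrow> (t ^^ n) ((s [^]\<^bsub>R\<^esub> n) \<odot>\<^bsub>M\<^esub> m) = m" for n :: nat
  by (induction n arbitrary: m) (simp_all add: smult_one smult_assoc1)

lemma t_funpow_commute: "(t ^^ n) ((t ^^ m) v) = (t ^^ m) ((t ^^ n) v)"
  by (metis add.commute comp_apply funpow_add)

lemma faithful_eqI:
  assumes "a \<in> carrier R" "b \<in> carrier R" "\<And>m. m \<in> carrier M \<Longrightarrow> a \<odot>\<^bsub>M\<^esub> m = b \<odot>\<^bsub>M\<^esub> m"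
  shows "a = b"
proof -
  have "(a \<ominus>\<^bsub>R\<^esub> b) \<odot>\<^bsub>M\<^esub> m = \<zero>\<^bsub>M\<^esub>" if m: "m \<in> carrier M" for m
  proof -
    have "(a \<ominus>\<^bsub>R\<^esub> b) \<odot>\<^bsub>M\<^esub> m = (b \<oplus>\<^bsub>R\<^esub> (\<ominus>\<^bsub>R\<^esub> b)) \<odot>\<^bsub>M\<^esub> m"
      using assms m by (simp add: a_minus_def smult_l_distr)
    then show ?thesis using assms m by (simp add: R.r_neg)
  qed
  then have "a \<ominus>\<^bsub>R\<^esub> b = \<zero>\<^bsub>R\<^esub>" using faithful assms(1,2) by (simp add: faithful_module_def)
  then show ?thesis using assms(1,2) by (simp add: R.r_right_minus_eq)
qed

text \<open>The cross-multiplied equation becomes equality of two endomorphisms of M: forwards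
  because powers of t commute, backwards by faithfulness. Transitivity of \<open>frac_rel\<close>
  and well-definedness of operations on fractions thereby become evident.\<close>

lemma frac_rel_iff:
  "((n, a), (m, b)) \<in> frac_rel R s \<longleftrightarrow> a \<in> carrier R \<and> b \<in> carrier R \<and>
     (\<forall>v\<in>carrier M. (t ^^ n) (a \<odot>\<^bsub>M\<^esub> v) = (t ^^ m) (b \<odot>\<^bsub>M\<^esub> v))"
proof -
  have "s [^]\<^bsub>R\<^esub> m \<otimes>\<^bsub>R\<^esub> a = s [^]\<^bsub>R\<^esub> n \<otimes>\<^bsub>R\<^esub> b \<longleftrightarrow>
      (\<forall>v\<in>carrier M. (t ^^ n) (a \<odot>\<^bsub>M\<^esub> v) = (t ^^ m) (b \<odot>\<^bsub>M\<^esub> v))"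
    if a: "a \<in> carrier R" and b: "b \<in> carrier R"
  proof (intro iffI ballI)
    fix v assume v: "v \<in> carrier M" and eq: "s [^]\<^bsub>R\<^esub> m \<otimes>\<^bsub>R\<^esub> a = s [^]\<^bsub>R\<^esub> n \<otimes>\<^bsub>R\<^esub> b"
    have "(t ^^ n) (a \<odot>\<^bsub>M\<^esub> v) = (t ^^ n) ((t ^^ m) ((s [^]\<^bsub>R\<^esub> m \<otimes>\<^bsub>R\<^esub> a) \<odot>\<^bsub>M\<^esub> v))"
      using a v by (simp add: smult_assoc1)
    also have "\<dots> = (t ^^ m) ((t ^^ n) ((s [^]\<^bsub>R\<^esub> n \<otimes>\<^bsub>R\<^esub> b) \<odot>\<^bsub>M\<^esub> v))"
      unfolding eq by (rule t_funpow_commute)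
    also have "\<dots> = (t ^^ m) (b \<odot>\<^bsub>M\<^esub> v)" using b v by (simp add: smult_assoc1)
    finally show "(t ^^ n) (a \<odot>\<^bsub>M\<^esub> v) = (t ^^ m) (b \<odot>\<^bsub>M\<^esub> v)" .
  next
    assume eq: "\<forall>v\<in>carrier M. (t ^^ n) (a \<odot>\<^bsub>M\<^esub> v) = (t ^^ m) (b \<odot>\<^bsub>M\<^esub> v)"
    show "s [^]\<^bsub>R\<^esub> m \<otimes>\<^bsub>R\<^esub> a = s [^]\<^bsub>R\<^esub> n \<otimes>\<^bsub>R\<^esub> b"
    proof (rule faithful_eqI)
      fix v assume v: "v \<in> carrier M"
      have "(s [^]\<^bsub>R\<^esub> m \<otimes>\<^bsub>R\<^esub> a) \<odot>\<^bsub>M\<^esub> v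
          = (s [^]\<^bsub>R\<^esub> m \<otimes>\<^bsub>R\<^esub> s [^]\<^bsub>R\<^esub> n) \<odot>\<^bsub>M\<^esub> ((t ^^ n) (a \<odot>\<^bsub>M\<^esub> v))"
        using a v by (simp add: smult_assoc1)
      also have "\<dots> = (s [^]\<^bsub>R\<^esub> n \<otimes>\<^bsub>R\<^esub> s [^]\<^bsub>R\<^esub> m) \<odot>\<^bsub>M\<^esub> ((t ^^ m) (b \<odot>\<^bsub>M\<^esub> v))"
        using eq v by (simp add: R.nat_pow_mult add.commute)
      also have "\<dots> = (s [^]\<^bsub>R\<^esub> n \<otimes>\<^bsub>R\<^esub> b) \<odot>\<^bsub>M\<^esub> v"
        using b v by (simp add: smult_assoc1)
      finally show "(s [^]\<^bsub>R\<^esub> m \<otimes>\<^bsub>R\<^esub> a) \<odot>\<^bsub>M\<^esub> v = (s [^]\<^bsub>R\<^esub> n \<otimes>\<^bsub>R\<^esub> b) \<odot>\<^bsub>M\<^esub> v" .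
    qed (use a b in auto)
  qed
  then show ?thesis by (auto simp: frac_rel_def)
qed

lemma mem_fraction_iff:
  assumes "a \<in> carrier R"
  shows "(m, b) \<in> fraction R s n a \<longleftrightarrow>
     b \<in> carrier R \<and> (\<forall>v\<in>carrier M. (t ^^ n) (a \<odot>\<^bsub>M\<^esub> v) = (t ^^ m) (b \<odot>\<^bsub>M\<^esub> v))"
  using assms by (simp add: fraction_def frac_rel_iff)

lemma fraction_self: "a \<in> carrier R \<Longrightarrow> (n, a) \<in> fraction R s n a"
  by (simp add: mem_fraction_iff)

lemma fraction_eqI:
  assumes "a \<in> carrier R" "b \<in> carrier R"
    and "\<And>v. v \<in> carrier M \<Longrightarrow> (t ^^ n) (a \<odot>\<^bsub>M\<^esub> v) = (t ^^ m) (b \<odot>\<^bsub>M\<^esub> v)"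
  shows "fraction R s n a = fraction R s m b"
  using assms by (auto simp: mem_fraction_iff)

definition frac_act :: "(nat \<times> 'r) set \<Rightarrow> 'm \<Rightarrow> 'm" where
  "frac_act P v = (case SOME p. p \<in> P of (n, a) \<Rightarrow> (t ^^ n) (a \<odot>\<^bsub>M\<^esub> v))"

lemma frac_act_fraction [simp]:
  assumes "a \<in> carrier R" "v \<in> carrier M"
  shows "frac_act (fraction R s n a) v = (t ^^ n) (a \<odot>\<^bsub>M\<^esub> v)"
proof -
  have "(SOME p. p \<in> fraction R s n a) \<in> fraction R s n a"
    using fraction_self[OF assms(1)] by (rule someI)
  then show ?thesis
    using assms by (cases "SOME p. p \<in> fraction R s n a") (simp add: frac_act_def mem_fraction_iff)
qed

lemma carrier_L: "P \<in> carrier L \<longleftrightarrow> (\<exists>n a. a \<in> carrier R \<and> P = fraction R s n a)"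
  by (auto simp: localization_def)

lemma fraction_closed [simp, intro]: "a \<in> carrier R \<Longrightarrow> fraction R s n a \<in> carrier L"
  by (auto simp: carrier_L)

text \<open>The extended action is again faithful, so each ring axiom of \<open>L\<close> reduces to
  an identity between endomorphisms of M.\<close>

lemma L_eqI:
  assumes "P \<in> carrier L" "Q \<in> carrier L" "\<And>v. v \<in> carrier M \<Longrightarrow> frac_act P v = frac_act Q v"
  shows "P = Q"
proof -
  from assms(1,2) obtain n a m b where *: "a \<in> carrier R" "b \<in> carrier R"
    "P = fraction R s n a" "Q = fraction R s m b" unfolding carrier_L by blast
  show ?thesis unfolding *(3,4)
    by (rule fraction_eqI) (use * assms(3) in auto)
qed

lemma s_pow_normal:
  assumes "a \<in> carrier R"
  shows "\<exists>a'\<in>carrier R. s [^]\<^bsub>R\<^esub> (n :: nat) \<otimes>\<^bsub>R\<^esub> a = a' \<otimes>\<^bsub>R\<^esub> s [^]\<^bsub>R\<^esub> n"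
proof (induction n)
  case 0
  show ?case using assms by auto
next
  case (Suc n)
  then obtain b where b: "b \<in> carrier R" "s [^]\<^bsub>R\<^esub> n \<otimes>\<^bsub>R\<^esub> a = b \<otimes>\<^bsub>R\<^esub> s [^]\<^bsub>R\<^esub> n" by blast
  obtain c where c: "c \<in> carrier R" "s \<otimes>\<^bsub>R\<^esub> b = c \<otimes>\<^bsub>R\<^esub> s" using s_normal[OF b(1)] by blast
  have "s [^]\<^bsub>R\<^esub> Suc n \<otimes>\<^bsub>R\<^esub> a = s \<otimes>\<^bsub>R\<^esub> (s [^]\<^bsub>R\<^esub> n \<otimes>\<^bsub>R\<^esub> a)"
    using assms by (simp only: R.nat_pow_Suc2 R.nat_pow_closed R.m_assoc s_closed)
  also have "\<dots> = s \<otimes>\<^bsub>R\<^esub> b \<otimes>\<^bsub>R\<^esub> s [^]\<^bsub>R\<^esub> n"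
    unfolding b(2) using b(1) by (simp add: R.m_assoc)
  also have "\<dots> = c \<otimes>\<^bsub>R\<^esub> s [^]\<^bsub>R\<^esub> Suc n"
    unfolding c(2) using c(1) by (simp only: R.nat_pow_Suc2 R.nat_pow_closed R.m_assoc s_closed)
  finally show ?case using c(1) by blast
qed

text \<open>The equation s^m a = a' s^m rewritten for inverse powers: s^(-m) a' = a s^(-m). This is
  what makes the product formula for left fractions agree with composition of the actions.\<close>

lemma t_funpow_normal:
  assumes "a \<in> carrier R" "a' \<in> carrier R" "v \<in> carrier M"
    and "s [^]\<^bsub>R\<^esub> m \<otimes>\<^bsub>R\<^esub> a = a' \<otimes>\<^bsub>R\<^esub> s [^]\<^bsub>R\<^esub> (m :: nat)"
  shows "(t ^^ m) (a' \<odot>\<^bsub>M\<^esub> v) = a \<odot>\<^bsub>M\<^esub> ((t ^^ m) v)"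
proof -
  have "(t ^^ m) (a' \<odot>\<^bsub>M\<^esub> v) = (t ^^ m) ((a' \<otimes>\<^bsub>R\<^esub> s [^]\<^bsub>R\<^esub> m) \<odot>\<^bsub>M\<^esub> ((t ^^ m) v))"
    using assms(1-3) by (simp add: smult_assoc1)
  also have "\<dots> = (t ^^ m) ((s [^]\<^bsub>R\<^esub> m) \<odot>\<^bsub>M\<^esub> (a \<odot>\<^bsub>M\<^esub> ((t ^^ m) v)))"
    using assms(1-3) by (simp add: smult_assoc1 flip: assms(4))
  finally show ?thesis using assms(1-3) by simp
qed

text \<open>The product is defined as a union over all representatives and all admissible a'. Every
  fraction in that union acts as the composite of the two given actions, so they all
  coincide.\<close>

lemma fraction_mult:
  assumes "a \<in> carrier R" "b \<in> carrier R" "a' \<in> carrier R"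
    and "s [^]\<^bsub>R\<^esub> m \<otimes>\<^bsub>R\<^esub> a = a' \<otimes>\<^bsub>R\<^esub> s [^]\<^bsub>R\<^esub> m"
  shows "fraction R s n a \<otimes>\<^bsub>L\<^esub> fraction R s m b = fraction R s (n + m) (a' \<otimes>\<^bsub>R\<^esub> b)"
proof -
  let ?X = "fraction R s (n + m) (a' \<otimes>\<^bsub>R\<^esub> b)"
  have eq: "fraction R s (n1 + m1) (c \<otimes>\<^bsub>R\<^esub> b1) = ?X"
    if P: "(n1, a1) \<in> fraction R s n a" and Q: "(m1, b1) \<in> fraction R s m b"
      and c: "c \<in> carrier R" "s [^]\<^bsub>R\<^esub> m1 \<otimes>\<^bsub>R\<^esub> a1 = c \<otimes>\<^bsub>R\<^esub> s [^]\<^bsub>R\<^esub> m1" for n1 a1 m1 b1 c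
  proof (rule fraction_eqI)
    from P Q have 1: "a1 \<in> carrier R" "b1 \<in> carrier R"
      and 2: "\<And>v. v \<in> carrier M \<Longrightarrow> (t ^^ n) (a \<odot>\<^bsub>M\<^esub> v) = (t ^^ n1) (a1 \<odot>\<^bsub>M\<^esub> v)"
      and 3: "\<And>v. v \<in> carrier M \<Longrightarrow> (t ^^ m) (b \<odot>\<^bsub>M\<^esub> v) = (t ^^ m1) (b1 \<odot>\<^bsub>M\<^esub> v)"
      using assms by (auto simp: mem_fraction_iff)
    show "c \<otimes>\<^bsub>R\<^esub> b1 \<in> carrier R" "a' \<otimes>\<^bsub>R\<^esub> b \<in> carrier R" using assms c 1 by auto
    fix v assume v: "v \<in> carrier M"
    have "(t ^^ (n1 + m1)) ((c \<otimes>\<^bsub>R\<^esub> b1) \<odot>\<^bsub>M\<^esub> v) = (t ^^ n1) (a1 \<odot>\<^bsub>M\<^esub> ((t ^^ m1) (b1 \<odot>\<^bsub>M\<^esub> v)))"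
      using c 1 v by (simp add: funpow_add smult_assoc1 t_funpow_normal[OF _ _ _ c(2)])
    also have "\<dots> = (t ^^ n) (a \<odot>\<^bsub>M\<^esub> ((t ^^ m) (b \<odot>\<^bsub>M\<^esub> v)))"
      using 1 assms v by (simp add: 2 flip: 3)
    also have "\<dots> = (t ^^ (n + m)) ((a' \<otimes>\<^bsub>R\<^esub> b) \<odot>\<^bsub>M\<^esub> v)"
      using assms v by (simp add: funpow_add smult_assoc1 t_funpow_normal[OF _ _ _ assms(4)])
    finally show "(t ^^ (n1 + m1)) ((c \<otimes>\<^bsub>R\<^esub> b1) \<odot>\<^bsub>M\<^esub> v) = (t ^^ (n + m)) ((a' \<otimes>\<^bsub>R\<^esub> b) \<odot>\<^bsub>M\<^esub> v)" .
  qed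
  have "fraction R s n a \<otimes>\<^bsub>L\<^esub> fraction R s m b \<subseteq> ?X"
    unfolding localization_def using eq by auto
  moreover have "?X \<subseteq> fraction R s n a \<otimes>\<^bsub>L\<^esub> fraction R s m b"
  proof
    fix p assume "p \<in> ?X"
    then have "\<exists>P\<in>fraction R s n a. \<exists>Q\<in>fraction R s m b.
        \<exists>c\<in>{c \<in> carrier R. s [^]\<^bsub>R\<^esub> fst Q \<otimes>\<^bsub>R\<^esub> snd P = c \<otimes>\<^bsub>R\<^esub> s [^]\<^bsub>R\<^esub> fst Q}.
          p \<in> fraction R s (fst P + fst Q) (c \<otimes>\<^bsub>R\<^esub> snd Q)"
      by (rule_tac x = "(n, a)" in bexI, rule_tac x = "(m, b)" in bexI, rule_tac x = a' in bexI)
        (use assms in \<open>simp_all add: fraction_self\<close>)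
    then show "p \<in> fraction R s n a \<otimes>\<^bsub>L\<^esub> fraction R s m b"
      by (simp add: localization_def split_beta)
  qed
  ultimately show ?thesis by blast
qed

text \<open>As for products, all fractions in the defining union act alike, here as the sum of the
  two actions; the second claim records that action.\<close>

lemma fraction_add:
  assumes "a \<in> carrier R" "b \<in> carrier R"
  shows "fraction R s n a \<oplus>\<^bsub>L\<^esub> fraction R s m b
    = fraction R s (n + m) (s [^]\<^bsub>R\<^esub> m \<otimes>\<^bsub>R\<^esub> a \<oplus>\<^bsub>R\<^esub> s [^]\<^bsub>R\<^esub> n \<otimes>\<^bsub>R\<^esub> b)"
    (is "_ = ?X")
    and "v \<in> carrier M \<Longrightarrow> (t ^^ (n + m)) ((s [^]\<^bsub>R\<^esub> m \<otimes>\<^bsub>R\<^esub> a \<oplus>\<^bsub>R\<^esub> s [^]\<^bsub>R\<^esub> n \<otimes>\<^bsub>R\<^esub> b) \<odot>\<^bsub>M\<^esub> v)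
      = (t ^^ n) (a \<odot>\<^bsub>M\<^esub> v) \<oplus>\<^bsub>M\<^esub> (t ^^ m) (b \<odot>\<^bsub>M\<^esub> v)"
proof -
  have act: "(t ^^ (n + m)) ((s [^]\<^bsub>R\<^esub> m \<otimes>\<^bsub>R\<^esub> a \<oplus>\<^bsub>R\<^esub> s [^]\<^bsub>R\<^esub> n \<otimes>\<^bsub>R\<^esub> b) \<odot>\<^bsub>M\<^esub> v)
      = (t ^^ n) (a \<odot>\<^bsub>M\<^esub> v) \<oplus>\<^bsub>M\<^esub> (t ^^ m) (b \<odot>\<^bsub>M\<^esub> v)"
    if "v \<in> carrier M" "a \<in> carrier R" "b \<in> carrier R" for v a b n m
  proof -
    have "(t ^^ (n + m)) ((s [^]\<^bsub>R\<^esub> m \<otimes>\<^bsub>R\<^esub> a \<oplus>\<^bsub>R\<^esub> s [^]\<^bsub>R\<^esub> n \<otimes>\<^bsub>R\<^esub> b) \<odot>\<^bsub>M\<^esub> v)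
        = (t ^^ n) ((t ^^ m) ((s [^]\<^bsub>R\<^esub> m) \<odot>\<^bsub>M\<^esub> (a \<odot>\<^bsub>M\<^esub> v)))
          \<oplus>\<^bsub>M\<^esub> (t ^^ n) ((t ^^ m) ((s [^]\<^bsub>R\<^esub> n) \<odot>\<^bsub>M\<^esub> (b \<odot>\<^bsub>M\<^esub> v)))"
      using that by (simp add: funpow_add smult_l_distr smult_assoc1 t_funpow_add)
    also have "(t ^^ n) ((t ^^ m) ((s [^]\<^bsub>R\<^esub> n) \<odot>\<^bsub>M\<^esub> (b \<odot>\<^bsub>M\<^esub> v)))
        = (t ^^ m) ((t ^^ n) ((s [^]\<^bsub>R\<^esub> n) \<odot>\<^bsub>M\<^esub> (b \<odot>\<^bsub>M\<^esub> v)))"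
      by (rule t_funpow_commute)
    finally show ?thesis using that by simp
  qed
  from act assms show "v \<in> carrier M \<Longrightarrow>
    (t ^^ (n + m)) ((s [^]\<^bsub>R\<^esub> m \<otimes>\<^bsub>R\<^esub> a \<oplus>\<^bsub>R\<^esub> s [^]\<^bsub>R\<^esub> n \<otimes>\<^bsub>R\<^esub> b) \<odot>\<^bsub>M\<^esub> v)
      = (t ^^ n) (a \<odot>\<^bsub>M\<^esub> v) \<oplus>\<^bsub>M\<^esub> (t ^^ m) (b \<odot>\<^bsub>M\<^esub> v)" by blast
  have eq: "fraction R s (n1 + m1) (s [^]\<^bsub>R\<^esub> m1 \<otimes>\<^bsub>R\<^esub> a1 \<oplus>\<^bsub>R\<^esub> s [^]\<^bsub>R\<^esub> n1 \<otimes>\<^bsub>R\<^esub> b1) = ?X"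
    if P: "(n1, a1) \<in> fraction R s n a" and Q: "(m1, b1) \<in> fraction R s m b" for n1 a1 m1 b1
  proof (rule fraction_eqI)
    from P Q have 1: "a1 \<in> carrier R" "b1 \<in> carrier R"
      and 2: "\<And>v. v \<in> carrier M \<Longrightarrow> (t ^^ n) (a \<odot>\<^bsub>M\<^esub> v) = (t ^^ n1) (a1 \<odot>\<^bsub>M\<^esub> v)"
      and 3: "\<And>v. v \<in> carrier M \<Longrightarrow> (t ^^ m) (b \<odot>\<^bsub>M\<^esub> v) = (t ^^ m1) (b1 \<odot>\<^bsub>M\<^esub> v)"
      using assms by (auto simp: mem_fraction_iff)
    show "s [^]\<^bsub>R\<^esub> m1 \<otimes>\<^bsub>R\<^esub> a1 \<oplus>\<^bsub>R\<^esub> s [^]\<^bsub>R\<^esub> n1 \<otimes>\<^bsub>R\<^esub> b1 \<in> carrier R"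
      "s [^]\<^bsub>R\<^esub> m \<otimes>\<^bsub>R\<^esub> a \<oplus>\<^bsub>R\<^esub> s [^]\<^bsub>R\<^esub> n \<otimes>\<^bsub>R\<^esub> b \<in> carrier R"
      using assms 1 by auto
    fix v assume v: "v \<in> carrier M"
    show "(t ^^ (n1 + m1)) ((s [^]\<^bsub>R\<^esub> m1 \<otimes>\<^bsub>R\<^esub> a1 \<oplus>\<^bsub>R\<^esub> s [^]\<^bsub>R\<^esub> n1 \<otimes>\<^bsub>R\<^esub> b1) \<odot>\<^bsub>M\<^esub> v)
      = (t ^^ (n + m)) ((s [^]\<^bsub>R\<^esub> m \<otimes>\<^bsub>R\<^esub> a \<oplus>\<^bsub>R\<^esub> s [^]\<^bsub>R\<^esub> n \<otimes>\<^bsub>R\<^esub> b) \<odot>\<^bsub>M\<^esub> v)"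
      unfolding act[OF v 1] act[OF v assms] using 2[OF v] 3[OF v] by simp
  qed
  have "fraction R s n a \<oplus>\<^bsub>L\<^esub> fraction R s m b \<subseteq> ?X"
    unfolding localization_def using eq by auto
  moreover have "?X \<subseteq> fraction R s n a \<oplus>\<^bsub>L\<^esub> fraction R s m b"
  proof
    fix p assume "p \<in> ?X"
    then have "\<exists>P\<in>fraction R s n a. \<exists>Q\<in>fraction R s m b. p \<in> fraction R s (fst P + fst Q)
        (s [^]\<^bsub>R\<^esub> fst Q \<otimes>\<^bsub>R\<^esub> snd P \<oplus>\<^bsub>R\<^esub> s [^]\<^bsub>R\<^esub> fst P \<otimes>\<^bsub>R\<^esub> snd Q)"
      by (rule_tac x = "(n, a)" in bexI, rule_tac x = "(m, b)" in bexI)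
        (use assms in \<open>simp_all add: fraction_self\<close>)
    then show "p \<in> fraction R s n a \<oplus>\<^bsub>L\<^esub> fraction R s m b"
      by (simp add: localization_def split_beta)
  qed
  ultimately show "fraction R s n a \<oplus>\<^bsub>L\<^esub> fraction R s m b = ?X" by blast
qed

lemma L_one: "\<one>\<^bsub>L\<^esub> = fraction R s 0 \<one>\<^bsub>R\<^esub>" and L_zero: "\<zero>\<^bsub>L\<^esub> = fraction R s 0 \<zero>\<^bsub>R\<^esub>"
  by (simp_all add: localization_def)

lemma L_closed [simp, intro]:
  assumes "P \<in> carrier L" "Q \<in> carrier L"
  shows "P \<oplus>\<^bsub>L\<^esub> Q \<in> carrier L" "P \<otimes>\<^bsub>L\<^esub> Q \<in> carrier L"
proof -
  from assms obtain n a m b where *: "a \<in> carrier R" "b \<in> carrier R"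
    "P = fraction R s n a" "Q = fraction R s m b" unfolding carrier_L by blast
  then show "P \<oplus>\<^bsub>L\<^esub> Q \<in> carrier L" by (simp add: fraction_add(1))
  obtain a' where "a' \<in> carrier R" "s [^]\<^bsub>R\<^esub> m \<otimes>\<^bsub>R\<^esub> a = a' \<otimes>\<^bsub>R\<^esub> s [^]\<^bsub>R\<^esub> m"
    using s_pow_normal[OF *(1)] by blast
  with * show "P \<otimes>\<^bsub>L\<^esub> Q \<in> carrier L" by (simp add: fraction_mult)
qed

lemma L_unit_closed [simp]: "\<one>\<^bsub>L\<^esub> \<in> carrier L" "\<zero>\<^bsub>L\<^esub> \<in> carrier L"
  by (simp_all add: L_one L_zero)

lemma frac_act_closed [simp, intro]: "P \<in> carrier L \<Longrightarrow> v \<in> carrier M \<Longrightarrow> frac_act P v \<in> carrier M"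
  by (auto simp: carrier_L)

lemma frac_act_one_zero [simp]:
  assumes "v \<in> carrier M"
  shows "frac_act \<one>\<^bsub>L\<^esub> v = v" "frac_act \<zero>\<^bsub>L\<^esub> v = \<zero>\<^bsub>M\<^esub>"
  using assms by (simp_all add: L_one L_zero smult_one)

lemma frac_act_simps [simp]:
  assumes "P \<in> carrier L" "v \<in> carrier M"
  shows "Q \<in> carrier L \<Longrightarrow> frac_act (P \<oplus>\<^bsub>L\<^esub> Q) v = frac_act P v \<oplus>\<^bsub>M\<^esub> frac_act Q v"
    "Q \<in> carrier L \<Longrightarrow> frac_act (P \<otimes>\<^bsub>L\<^esub> Q) v = frac_act P (frac_act Q v)"
    "w \<in> carrier M \<Longrightarrow> frac_act P (v \<oplus>\<^bsub>M\<^esub> w) = frac_act P v \<oplus>\<^bsub>M\<^esub> frac_act P w"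
proof -
  from assms obtain n a where P: "a \<in> carrier R" "P = fraction R s n a" unfolding carrier_L by blast
  show "frac_act P (v \<oplus>\<^bsub>M\<^esub> w) = frac_act P v \<oplus>\<^bsub>M\<^esub> frac_act P w" if "w \<in> carrier M"
    using that assms P by (simp add: smult_r_distr t_funpow_add)
  assume "Q \<in> carrier L"
  then obtain m b where Q: "b \<in> carrier R" "Q = fraction R s m b" unfolding carrier_L by blast
  show "frac_act (P \<oplus>\<^bsub>L\<^esub> Q) v = frac_act P v \<oplus>\<^bsub>M\<^esub> frac_act Q v"
    using P Q assms fraction_add[OF P(1) Q(1)] by simp
  obtain a' where a': "a' \<in> carrier R" "s [^]\<^bsub>R\<^esub> m \<otimes>\<^bsub>R\<^esub> a = a' \<otimes>\<^bsub>R\<^esub> s [^]\<^bsub>R\<^esub> m"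
    using s_pow_normal[OF P(1)] by blast
  have "frac_act (P \<otimes>\<^bsub>L\<^esub> Q) v = (t ^^ (n + m)) ((a' \<otimes>\<^bsub>R\<^esub> b) \<odot>\<^bsub>M\<^esub> v)"
    using P Q a' assms by (simp add: fraction_mult)
  also have "\<dots> = frac_act P (frac_act Q v)"
    using P Q a'(1) assms by (simp add: funpow_add smult_assoc1 t_funpow_normal[OF _ _ _ a'(2)])
  finally show "frac_act (P \<otimes>\<^bsub>L\<^esub> Q) v = frac_act P (frac_act Q v)" .
qed

lemma L_neg:
  assumes "P \<in> carrier L" shows "\<exists>Q\<in>carrier L. Q \<oplus>\<^bsub>L\<^esub> P = \<zero>\<^bsub>L\<^esub>"
proof -
  from assms obtain n a where P: "a \<in> carrier R" "P = fraction R s n a" unfolding carrier_L by blast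
  let ?Q = "fraction R s n (\<ominus>\<^bsub>R\<^esub> a)"
  have "?Q \<oplus>\<^bsub>L\<^esub> P = \<zero>\<^bsub>L\<^esub>"
  proof (rule L_eqI)
    fix v assume v: "v \<in> carrier M"
    have "frac_act (?Q \<oplus>\<^bsub>L\<^esub> P) v = (t ^^ n) (((\<ominus>\<^bsub>R\<^esub> a) \<oplus>\<^bsub>R\<^esub> a) \<odot>\<^bsub>M\<^esub> v)"
      using P v by (simp add: t_funpow_add smult_l_distr)
    then show "frac_act (?Q \<oplus>\<^bsub>L\<^esub> P) v = frac_act \<zero>\<^bsub>L\<^esub> v"
      using P v by (simp add: R.l_neg t_funpow_zero)
  qed (use P in auto)
  then show ?thesis using P by blast
qed

lemma ring_L: "ring L"
proof (rule ringI)
  show "abelian_group L"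
    by (rule abelian_groupI; (rule L_eqI)?; simp add: L_neg M.a_ac)
  show "Group.monoid L"
    by (rule monoidI; (rule L_eqI)?; simp)
qed (rule L_eqI; simp)+

definition localized_module :: "((nat \<times> 'r) set, 'm) module" where
  "localized_module = \<lparr>carrier = carrier M, monoid.mult = monoid.mult M, monoid.one = monoid.one M,
     ring.zero = ring.zero M, ring.add = ring.add M, module.smult = frac_act\<rparr>"

lemma localized_module_simps [simp]:
  "carrier localized_module = carrier M" "ring.add localized_module = ring.add M"
  "ring.zero localized_module = ring.zero M" "module.smult localized_module = frac_act"
  by (simp_all add: localized_module_def)

lemma left_module_localized: "left_module L localized_module"
proof (intro left_module.intro left_module_axioms.intro)
  show "abelian_group localized_module"
  proof (rule abelian_groupI)
    fix x assume "x \<in> carrier localized_module"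
    then show "\<exists>y\<in>carrier localized_module. y \<oplus>\<^bsub>localized_module\<^esub> x = \<zero>\<^bsub>localized_module\<^esub>"
      using M.l_neg[of x] M.a_inv_closed[of x] by auto
  qed (simp_all add: M.a_ac)
qed (simp_all add: ring_L)

lemma inv_L_s: "inv\<^bsub>L\<^esub> (fraction R s 0 s) = fraction R s 1 \<one>\<^bsub>R\<^esub>"
proof -
  interpret L: ring L by (rule ring_L)
  show ?thesis
    by (rule L.inv_char; (rule L_eqI)?; simp add: smult_one)
qed

lemma extends_localized: "extends_to_localization R s M localized_module"
  unfolding extends_to_localization_def
  by (auto simp: left_module_localized inv_L_s smult_one t_def[symmetric])

text \<open>R acts through the fractions with denominator s^0, so a submodule over the localization
  is also one over R, and simplicity is inherited.\<close>

lemma simple_localized: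
  assumes "simple_module R M" shows "simple_module L localized_module"
  unfolding simple_module_def
proof (intro conjI allI impI)
  show "left_module L localized_module" by (rule left_module_localized)
  show "carrier localized_module \<noteq> {\<zero>\<^bsub>localized_module\<^esub>}"
    using assms by (simp add: simple_module_def)
  fix H assume "submodule H L localized_module"
  then interpret H: submodule H L localized_module .
  have "submodule H R M"
  proof (intro submodule.intro subgroup.intro submodule_axioms.intro)
    show sub: "H \<subseteq> carrier (add_monoid M)" using H.subset by simp
    show "x \<otimes>\<^bsub>add_monoid M\<^esub> y \<in> H" if "x \<in> H" "y \<in> H" for x y using H.m_closed[OF that] by simp
    show "\<one>\<^bsub>add_monoid M\<^esub> \<in> H" using H.one_closed by simp
    show smult: "a \<odot>\<^bsub>M\<^esub> x \<in> H" if "a \<in> carrier R" "x \<in> H" for a x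
    proof -
      have "fraction R s 0 a \<odot>\<^bsub>localized_module\<^esub> x \<in> H"
        using that by (intro H.smult_closed) auto
      moreover have "x \<in> carrier M" using sub that(2) by auto
      ultimately show ?thesis using that(1) by simp
    qed
    fix x assume x: "x \<in> H"
    then have xM: "x \<in> carrier M" using sub by auto
    have "(\<ominus>\<^bsub>R\<^esub> \<one>\<^bsub>R\<^esub>) \<odot>\<^bsub>M\<^esub> x \<oplus>\<^bsub>M\<^esub> x = ((\<ominus>\<^bsub>R\<^esub> \<one>\<^bsub>R\<^esub>) \<oplus>\<^bsub>R\<^esub> \<one>\<^bsub>R\<^esub>) \<odot>\<^bsub>M\<^esub> x"
      using xM by (simp add: smult_l_distr smult_one)
    then have "\<ominus>\<^bsub>M\<^esub> x = (\<ominus>\<^bsub>R\<^esub> \<one>\<^bsub>R\<^esub>) \<odot>\<^bsub>M\<^esub> x"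
      using xM by (intro M.minus_equality) (simp_all add: R.l_neg)
    then have "\<ominus>\<^bsub>M\<^esub> x \<in> H" using smult[of "\<ominus>\<^bsub>R\<^esub> \<one>\<^bsub>R\<^esub>" x] x by simp
    then show "inv\<^bsub>add_monoid M\<^esub> x \<in> H" unfolding a_inv_def[symmetric] .
  qed
  then show "H = {\<zero>\<^bsub>localized_module\<^esub>} \<or> H = carrier localized_module"
    using assms by (simp add: simple_module_def)
qed

end

section \<open>Localization of the super Jordan plane and the classification\<close>

text \<open>The elements that s can pass in this way are closed under sums and products, and sy = (y
  - x)s settles the generator y.\<close>

lemma J_s_normal: "\<exists>a'. J_s * a = a' * J_s"
proof (induction a rule: super_jordan_induct)
  case (scalar c)
  then show ?case by (metis J_scalar_central)
next
  case x
  then show ?case by (metis super_jordan_rewrite(3))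
next
  case y
  have "J_s * J_y = (J_y - J_x) * (J_s :: 'a super_jordan)"
    by (simp add: left_diff_distrib super_jordan_rewrite)
  then show ?case by blast
next
  case (add a b)
  then show ?case by (metis distrib_left distrib_right)
next
  case (mult a b)
  then show ?case by (metis mult.assoc)
qed

lemma localizing_module_sjp:
  fixes M :: "('k::field free_alg set, 'm, 'z) module_scheme"
  assumes "sjp_module M" "faithful_module sjp M"
    and "bij_betw (\<lambda>m. sjp_s \<odot>\<^bsub>M\<^esub> m) (carrier M) (carrier M)"
  shows "localizing_module sjp M sjp_s"
proof -
  interpret sjp_module M by fact
  show ?thesis
  proof
    show "sjp_s \<in> carrier sjp" using Rep_carrier[of J_s] unfolding Rep_generators .
    fix a :: "'k free_alg set" assume a: "a \<in> carrier sjp"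
    obtain a' where "J_s * Abs_super_jordan a = a' * J_s" using J_s_normal by blast
    then have "Rep_super_jordan (J_s * Abs_super_jordan a) = Rep_super_jordan (a' * J_s)" by simp
    then have "sjp_s \<otimes>\<^bsub>sjp\<^esub> a = Rep_super_jordan a' \<otimes>\<^bsub>sjp\<^esub> sjp_s"
      using a by (simp add: Rep_generators Abs_super_jordan_inverse)
    then show "\<exists>a'\<in>carrier sjp. sjp_s \<otimes>\<^bsub>sjp\<^esub> a = a' \<otimes>\<^bsub>sjp\<^esub> sjp_s" using Rep_carrier by blast
  qed (use assms in auto)
qed

theorem corollary3p3:
  shows
    "(\<forall>\<alpha> :: 'k :: {alg_closed_field, field_char_0}.
        simple_module sjp (sjp_simple \<alpha>) \<and>
        finite_dimensional (underlying_space (sjp_simple \<alpha>))) \<and>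
     (\<forall>M :: ('k free_alg set, 'm) module.
        simple_module sjp M \<and> finite_dimensional (underlying_space M) \<longrightarrow>
          (\<exists>\<alpha>. module_isomorphic sjp M (sjp_simple \<alpha>)) \<and>
          has_dimension (underlying_space M) 1) \<and>
     (\<forall>M :: ('k free_alg set, 'm) module.
        simple_module sjp M \<longrightarrow>
          (\<not> finite_dimensional (underlying_space M) \<longleftrightarrow> faithful_module sjp M) \<and>
          (\<not> finite_dimensional (underlying_space M) \<longleftrightarrow>
             bij_betw (\<lambda>m. sjp_s \<odot>\<^bsub>M\<^esub> m) (carrier M) (carrier M)) \<and>
          (\<not> finite_dimensional (underlying_space M) \<longrightarrow>
             (\<exists>N :: ((nat \<times> 'k free_alg set) set, 'm) module.
                extends_to_localization sjp sjp_s M N \<and>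
                simple_module (localization sjp sjp_s) N)))"
proof (intro conjI[OF _ conjI] allI)
  fix \<alpha> :: 'k
  interpret S: sjp_module "sjp_simple \<alpha>" by (rule sjp_simple_line)
  obtain u where "S.line \<alpha> u" using sjp_simple_line(2) by blast
  from S.line_simple[OF this] S.line_has_dimension[OF this]
  show "simple_module sjp (sjp_simple \<alpha>) \<and>
      finite_dimensional (underlying_space (sjp_simple \<alpha>))"
    unfolding finite_dimensional_def by blast
next
  \<comment> \<open>Each alternative decides dimension, faithfulness and bijectivity of s at once,
    with opposite answers; both equivalences are then read off by cases.\<close>
  have dichotomy: "(\<exists>\<alpha> u. sjp_module.line M \<alpha> u) \<and> \<not> faithful_module sjp M \<and>
        finite_dimensional (underlying_space M) \<and> has_dimension (underlying_space M) 1 \<and>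
        \<not> bij_betw (\<lambda>m. sjp_s \<odot>\<^bsub>M\<^esub> m) (carrier M) (carrier M) \<or>
      faithful_module sjp M \<and> \<not> finite_dimensional (underlying_space M) \<and>
        bij_betw (\<lambda>m. sjp_s \<odot>\<^bsub>M\<^esub> m) (carrier M) (carrier M)"
    if "simple_module sjp M" for M :: "('k free_alg set, 'm) module"
  proof -
    interpret simple_sjp_module M by (rule simple_sjp_moduleI[OF that])
    have s: "act J_s = (\<lambda>m. sjp_s \<odot>\<^bsub>M\<^esub> m)" by (simp add: act_def Rep_generators fun_eq_iff)
    note infinite = s_bij_imp_infinite_dimensional[OF sjp_module_axioms nontrivial, unfolded s]
    note faithful = s_bij_imp_faithful[OF sjp_module_axioms nontrivial, unfolded s]
    from s_zero_or_bij show ?thesis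
    proof
      assume "\<forall>m\<in>carrier M. act J_s m = \<zero>\<^bsub>M\<^esub>"
      then obtain \<alpha> u where l: "line \<alpha> u"
        using ex_line alg_closed_imp_poly_has_root by blast
      have "finite_dimensional (underlying_space M)"
        using line_has_dimension[OF l] by (auto simp: finite_dimensional_def)
      then show ?thesis
        using l line_has_dimension[OF l] line_not_faithful[OF l] infinite by blast
    next
      assume "bij_betw (act J_s) (carrier M) (carrier M)"
      then show ?thesis using infinite faithful unfolding s by blast
    qed
  qed
  {
    fix M :: "('k free_alg set, 'm) module"
    show "simple_module sjp M \<and> finite_dimensional (underlying_space M) \<longrightarrow>
          (\<exists>\<alpha>. module_isomorphic sjp M (sjp_simple \<alpha>)) \<and> has_dimension (underlying_space M) 1"
    proof (intro impI, elim conjE)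
      assume M: "simple_module sjp M" "finite_dimensional (underlying_space M)"
      from dichotomy[OF M(1)] M(2) obtain \<alpha> u
        where u: "sjp_module.line M \<alpha> u" "has_dimension (underlying_space M) 1" by blast
      interpret simple_sjp_module M by (rule simple_sjp_moduleI[OF M(1)])
      obtain v where "sjp_module.line (sjp_simple \<alpha>) \<alpha> v" using sjp_simple_line(2) by blast
      with line_isomorphic[OF sjp_module_axioms sjp_simple_line(1) u(1)] u(2)
      show "(\<exists>\<alpha>. module_isomorphic sjp M (sjp_simple \<alpha>)) \<and> has_dimension (underlying_space M) 1"
        by blast
    qed
  next
    fix M :: "('k free_alg set, 'm) module"
    have "\<exists>N :: ((nat \<times> 'k free_alg set) set, 'm) module.
        extends_to_localization sjp sjp_s M N \<and> simple_module (localization sjp sjp_s) N"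
      if M: "simple_module sjp M" and inf: "\<not> finite_dimensional (underlying_space M)"
    proof -
      interpret simple_sjp_module M by (rule simple_sjp_moduleI[OF M])
      interpret localizing_module sjp M sjp_s
        using dichotomy[OF M] inf by (intro localizing_module_sjp sjp_module_axioms) auto
      show ?thesis using extends_localized simple_localized[OF M] by blast
    qed
    then show "simple_module sjp M \<longrightarrow>
          (\<not> finite_dimensional (underlying_space M) \<longleftrightarrow> faithful_module sjp M) \<and>
          (\<not> finite_dimensional (underlying_space M) \<longleftrightarrow>
             bij_betw (\<lambda>m. sjp_s \<odot>\<^bsub>M\<^esub> m) (carrier M) (carrier M)) \<and>
          (\<not> finite_dimensional (underlying_space M) \<longrightarrow>
             (\<exists>N :: ((nat \<times> 'k free_alg set) set, 'm) module.
                extends_to_localization sjp sjp_s M N \<and>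
                simple_module (localization sjp sjp_s) N))"
      using dichotomy[of M] by blast
  }
qed

end
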